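(* Let $k$ be an infinite field of characteristic $0$ such that $\mathrm{Aut}\,k=\{\mathrm{id}_k\}$. Then two representations $H_1,H_2\in\Xi$ of Lie algebras over $k$ are automorphically equivalent if and only if they are geometrically equivalent.
   Context: A representation $(L,V)$ consists of a Lie algebra $L$ over $k$ and a $k$-vector space $V$ which is an $L$-module (action $l\circ v$). A homomorphism $(\varphi,\psi):(L_1,V_1)\to(L_2,V_2)$ is a Lie algebra homomorphism $\varphi:L_1\to L_2$ and a linear map $\psi:V_1\to V_2$ with $\varphi(l)\circ\psi(v)=\psi(l\circ v)$. $\Xi$ is the class of all representations (viewed as 2-sorted algebras). For a set $X$ let $L(X)$ be the free Lie algebra on $X$, $A(X)$ the free associative algebra with unit on $X$, and $W(X,Y)=(L(X),A(X)Y)$ where $A(X)Y=\bigoplus_{y\in Y}A(X)y$ is the free $A(X)$-module with basis $Y$; this is the free representation on $(X,Y)$. Fix countably infinite sets $X^0,Y^0$; $\Xi^0$ is the category whose objects are the $W(X,Y)$ with finite $X\subset X^0$, $Y\subset Y^0$, and whose morphisms are all homomorphisms between them. For $H\in\Xi$, $W=W(X,Y)\in\mathrm{Ob}\,\Xi^0$ and $T_1\subseteq L(X)$, $T_2\subseteq A(X)Y$, let $(T_1,T_2)'_H=\{(\varphi,\psi)\in\mathrm{Hom}(W,H): T_1\subseteq\ker\varphi,\ T_2\subseteq\ker\psi\}$ and $(T_1,T_2)''_H=\big(\bigcap_{(\varphi,\psi)\in(T_1,T_2)'_H}\ker\varphi,\ \bigcap_{(\varphi,\psi)\in(T_1,T_2)'_H}\ker\psi\big)$.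 $(T_1,T_2)$ is $H$-closed if $(T_1,T_2)''_H=(T_1,T_2)$; $Cl_H(W)$ denotes the set of $H$-closed pairs in $W$. $H_1,H_2$ are geometrically equivalent if $(T_1,T_2)''_{H_1}=(T_1,T_2)''_{H_2}$ for all $W\in\mathrm{Ob}\,\Xi^0$ and all $(T_1,T_2)$ in $W$. For $W_1=W(X_1,Y_1),W_2=W(X_2,Y_2)$ and a congruence $(T_1,T_2)$ of $W_2$, $\beta_{W_1,W_2}(T_1,T_2)$ is the relation on $\mathrm{Hom}(W_1,W_2)$: $((\varphi_1,\psi_1),(\varphi_2,\psi_2))\in\beta$ iff $\varphi_1(l)-\varphi_2(l)\in T_1$ for all $l\in L(X_1)$ and $\psi_1(v)-\psi_2(v)\in T_2$ for all $v\in A(X_1)Y_1$. $H_1,H_2$ are automorphically equivalent if there exist an automorphism $\Phi$ of the category $\Xi^0$ and bijections $\alpha_W:Cl_{H_1}(W)\to Cl_{H_2}(\Phi(W))$ for all $W\in\mathrm{Ob}\,\Xi^0$ such that $\Phi(\beta_{W_1,W_2}(T_1,T_2))=\beta_{\Phi(W_1),\Phi(W_2)}(\alpha_{W_2}(T_1,T_2))$ for all $W_1,W_2$ and all $(T_1,T_2)\in Cl_{H_1}(W_2)$, where $\Phi$ acts on pairs of morphisms componentwise. *)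

theory Defs
  imports Complex_Main "HOL-Library.FuncSet" "HOL-Library.Function_Algebras"
begin

type_synonym ('k, 'l, 'v) rep =
  "('k \<Rightarrow> 'l \<Rightarrow> 'l) \<times> ('l \<Rightarrow> 'l \<Rightarrow> 'l) \<times> ('k \<Rightarrow> 'v \<Rightarrow> 'v) \<times> ('l \<Rightarrow> 'v \<Rightarrow> 'v)"
  \<comment> \<open>(scalar mult. on L, Lie bracket, scalar mult. on V, action l \<circ> v)\<close>

definition lie_algebra :: "('k::field \<Rightarrow> 'l::ab_group_add \<Rightarrow> 'l) \<Rightarrow> ('l \<Rightarrow> 'l \<Rightarrow> 'l) \<Rightarrow> bool" where
  "lie_algebra sL bL \<longleftrightarrow> vector_space sL
     \<and> (\<forall>a b c. bL (a + b) c = bL a c + bL b c)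
     \<and> (\<forall>a b c. bL a (b + c) = bL a b + bL a c)
     \<and> (\<forall>r a b. bL (sL r a) b = sL r (bL a b))
     \<and> (\<forall>r a b. bL a (sL r b) = sL r (bL a b))
     \<and> (\<forall>a. bL a a = 0)
     \<and> (\<forall>a b c. bL a (bL b c) + bL b (bL c a) + bL c (bL a b) = 0)"

definition is_rep :: "('k::field, 'l::ab_group_add, 'v::ab_group_add) rep \<Rightarrow> bool" where
  "is_rep H = (case H of (sL, bL, sV, act) \<Rightarrow>
     lie_algebra sL bL \<and> vector_space sV
     \<and> (\<forall>a b v. act (a + b) v = act a v + act b v)
     \<and> (\<forall>a v w. act a (v + w) = act a v + act a w)
     \<and> (\<forall>r a v. act (sL r a) v = sV r (act a v))
     \<and> (\<forall>r a v. act a (sV r v) = sV r (act a v))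
     \<and> (\<forall>a b v. act (bL a b) v = act a (act b v) - act b (act a v)))"

definition field_aut :: "('k::field \<Rightarrow> 'k) \<Rightarrow> bool" where
  "field_aut \<sigma> \<longleftrightarrow> bij \<sigma> \<and> (\<forall>a b. \<sigma> (a + b) = \<sigma> a + \<sigma> b) \<and> (\<forall>a b. \<sigma> (a * b) = \<sigma> a * \<sigma> b)"

text \<open>Noncommutative polynomials: finitely supported functions on words (nat list).
  Elements of A(X)Y: finitely supported functions on (word, generator of Y).\<close>

definition Afree :: "nat set \<Rightarrow> (nat list \<Rightarrow> 'k::field) set" where
  "Afree X = {p. finite {w. p w \<noteq> 0} \<and> (\<forall>w. p w \<noteq> 0 \<longrightarrow> set w \<subseteq> X)}"

definition AYfree :: "nat set \<Rightarrow> nat set \<Rightarrow> (nat list \<times> nat \<Rightarrow> 'k::field) set" where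
  "AYfree X Y = {m. finite {z. m z \<noteq> 0} \<and> (\<forall>w y. m (w, y) \<noteq> 0 \<longrightarrow> set w \<subseteq> X \<and> y \<in> Y)}"

definition psc :: "'k::field \<Rightarrow> ('a \<Rightarrow> 'k) \<Rightarrow> ('a \<Rightarrow> 'k)" where
  "psc c p = (\<lambda>z. c * p z)"

definition pmul :: "(nat list \<Rightarrow> 'k::field) \<Rightarrow> (nat list \<Rightarrow> 'k) \<Rightarrow> (nat list \<Rightarrow> 'k)" where
  "pmul p q = (\<lambda>w. \<Sum>i\<le>length w. p (take i w) * q (drop i w))"

definition pbr :: "(nat list \<Rightarrow> 'k::field) \<Rightarrow> (nat list \<Rightarrow> 'k) \<Rightarrow> (nat list \<Rightarrow> 'k)" where
  "pbr p q = pmul p q - pmul q p"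

definition pact :: "(nat list \<Rightarrow> 'k::field) \<Rightarrow> (nat list \<times> nat \<Rightarrow> 'k) \<Rightarrow> (nat list \<times> nat \<Rightarrow> 'k)" where
  "pact p m = (\<lambda>(w, y). \<Sum>i\<le>length w. p (take i w) * m (drop i w, y))"

definition pgen :: "nat \<Rightarrow> (nat list \<Rightarrow> 'k::field)" where
  "pgen x = (\<lambda>w. if w = [x] then 1 else 0)"

text \<open>Free Lie algebra L(X), realised (Witt) as the Lie subalgebra of A(X) generated by X.\<close>

inductive_set Lfree :: "nat set \<Rightarrow> (nat list \<Rightarrow> 'k::field) set" for X :: "nat set" where
  zero: "0 \<in> Lfree X"
| gen: "x \<in> X \<Longrightarrow> pgen x \<in> Lfree X"
| add: "p \<in> Lfree X \<Longrightarrow> q \<in> Lfree X \<Longrightarrow> p + q \<in> Lfree X"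
| smul: "p \<in> Lfree X \<Longrightarrow> psc c p \<in> Lfree X"
| br: "p \<in> Lfree X \<Longrightarrow> q \<in> Lfree X \<Longrightarrow> pbr p q \<in> Lfree X"

definition hom_gen ::
  "nat set \<Rightarrow> nat set \<Rightarrow> 'l set \<Rightarrow> 'v set \<Rightarrow> ('k::field \<Rightarrow> 'l::ab_group_add \<Rightarrow> 'l) \<Rightarrow> ('l \<Rightarrow> 'l \<Rightarrow> 'l)
   \<Rightarrow> ('k \<Rightarrow> 'v::ab_group_add \<Rightarrow> 'v) \<Rightarrow> ('l \<Rightarrow> 'v \<Rightarrow> 'v)
   \<Rightarrow> (((nat list \<Rightarrow> 'k) \<Rightarrow> 'l) \<times> ((nat list \<times> nat \<Rightarrow> 'k) \<Rightarrow> 'v)) set" where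
  "hom_gen X Y CL CV sL bL sV act = {(\<phi>, \<psi>).
      \<phi> \<in> extensional (Lfree X) \<and> \<psi> \<in> extensional (AYfree X Y)
    \<and> \<phi> ` Lfree X \<subseteq> CL \<and> \<psi> ` AYfree X Y \<subseteq> CV
    \<and> (\<forall>p\<in>Lfree X. \<forall>q\<in>Lfree X. \<phi> (p + q) = \<phi> p + \<phi> q \<and> \<phi> (pbr p q) = bL (\<phi> p) (\<phi> q))
    \<and> (\<forall>c. \<forall>p\<in>Lfree X. \<phi> (psc c p) = sL c (\<phi> p))
    \<and> (\<forall>u\<in>AYfree X Y. \<forall>v\<in>AYfree X Y. \<psi> (u + v) = \<psi> u + \<psi> v)
    \<and> (\<forall>c. \<forall>u\<in>AYfree X Y. \<psi> (psc c u) = sV c (\<psi> u))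
    \<and> (\<forall>l\<in>Lfree X. \<forall>v\<in>AYfree X Y. \<psi> (pact l v) = act (\<phi> l) (\<psi> v))}"

text \<open>Objects of \<Xi>^0 are identified with pairs (X,Y) of finite subsets of X^0 = Y^0 = nat.\<close>

type_synonym obj = "nat set \<times> nat set"

definition Ob :: "obj set" where
  "Ob = {(X, Y). finite X \<and> finite Y}"

definition homH :: "('k::field, 'l::ab_group_add, 'v::ab_group_add) rep \<Rightarrow> obj
    \<Rightarrow> (((nat list \<Rightarrow> 'k) \<Rightarrow> 'l) \<times> ((nat list \<times> nat \<Rightarrow> 'k) \<Rightarrow> 'v)) set" where
  "homH H W = (case H of (sL, bL, sV, act) \<Rightarrow> hom_gen (fst W) (snd W) UNIV UNIV sL bL sV act)"

definition homW :: "obj \<Rightarrow> obj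
    \<Rightarrow> (((nat list \<Rightarrow> 'k::field) \<Rightarrow> (nat list \<Rightarrow> 'k)) \<times> ((nat list \<times> nat \<Rightarrow> 'k) \<Rightarrow> (nat list \<times> nat \<Rightarrow> 'k))) set" where
  "homW A B = hom_gen (fst A) (snd A) (Lfree (fst B)) (AYfree (fst B) (snd B)) psc pbr psc pact"

definition compW :: "obj
    \<Rightarrow> (((nat list \<Rightarrow> 'k::field) \<Rightarrow> (nat list \<Rightarrow> 'k)) \<times> ((nat list \<times> nat \<Rightarrow> 'k) \<Rightarrow> (nat list \<times> nat \<Rightarrow> 'k)))
    \<Rightarrow> (((nat list \<Rightarrow> 'k) \<Rightarrow> (nat list \<Rightarrow> 'k)) \<times> ((nat list \<times> nat \<Rightarrow> 'k) \<Rightarrow> (nat list \<times> nat \<Rightarrow> 'k)))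
    \<Rightarrow> (((nat list \<Rightarrow> 'k) \<Rightarrow> (nat list \<Rightarrow> 'k)) \<times> ((nat list \<times> nat \<Rightarrow> 'k) \<Rightarrow> (nat list \<times> nat \<Rightarrow> 'k)))" where
  "compW A g f = (restrict (fst g \<circ> fst f) (Lfree (fst A)), restrict (snd g \<circ> snd f) (AYfree (fst A) (snd A)))"

definition idW :: "obj
    \<Rightarrow> (((nat list \<Rightarrow> 'k::field) \<Rightarrow> (nat list \<Rightarrow> 'k)) \<times> ((nat list \<times> nat \<Rightarrow> 'k) \<Rightarrow> (nat list \<times> nat \<Rightarrow> 'k)))" where
  "idW A = (restrict id (Lfree (fst A)), restrict id (AYfree (fst A) (snd A)))"

definition cat_auto :: "(obj \<Rightarrow> obj) \<Rightarrow> (obj \<Rightarrow> obj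
    \<Rightarrow> (((nat list \<Rightarrow> 'k::field) \<Rightarrow> (nat list \<Rightarrow> 'k)) \<times> ((nat list \<times> nat \<Rightarrow> 'k) \<Rightarrow> (nat list \<times> nat \<Rightarrow> 'k)))
    \<Rightarrow> (((nat list \<Rightarrow> 'k) \<Rightarrow> (nat list \<Rightarrow> 'k)) \<times> ((nat list \<times> nat \<Rightarrow> 'k) \<Rightarrow> (nat list \<times> nat \<Rightarrow> 'k)))) \<Rightarrow> bool" where
  "cat_auto Fo Fm \<longleftrightarrow> bij_betw Fo Ob Ob
    \<and> (\<forall>A\<in>Ob. \<forall>B\<in>Ob. bij_betw (Fm A B) (homW A B) (homW (Fo A) (Fo B)))
    \<and> (\<forall>A\<in>Ob. \<forall>B\<in>Ob. \<forall>C\<in>Ob. \<forall>f\<in>homW A B. \<forall>g\<in>homW B C.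
         Fm A C (compW A g f) = compW (Fo A) (Fm B C g) (Fm A B f))
    \<and> (\<forall>A\<in>Ob. Fm A A (idW A) = idW (Fo A))"

definition prime_H :: "('k::field, 'l::ab_group_add, 'v::ab_group_add) rep \<Rightarrow> obj
    \<Rightarrow> (nat list \<Rightarrow> 'k) set \<Rightarrow> (nat list \<times> nat \<Rightarrow> 'k) set
    \<Rightarrow> (((nat list \<Rightarrow> 'k) \<Rightarrow> 'l) \<times> ((nat list \<times> nat \<Rightarrow> 'k) \<Rightarrow> 'v)) set" where
  "prime_H H W T1 T2 = {(\<phi>, \<psi>) \<in> homH H W. (\<forall>l\<in>T1. \<phi> l = 0) \<and> (\<forall>v\<in>T2. \<psi> v = 0)}"

definition dprime_H :: "('k::field, 'l::ab_group_add, 'v::ab_group_add) rep \<Rightarrow> obj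
    \<Rightarrow> (nat list \<Rightarrow> 'k) set \<Rightarrow> (nat list \<times> nat \<Rightarrow> 'k) set
    \<Rightarrow> (nat list \<Rightarrow> 'k) set \<times> (nat list \<times> nat \<Rightarrow> 'k) set" where
  "dprime_H H W T1 T2 =
    ({l \<in> Lfree (fst W). \<forall>(\<phi>, \<psi>) \<in> prime_H H W T1 T2. \<phi> l = 0},
     {v \<in> AYfree (fst W) (snd W). \<forall>(\<phi>, \<psi>) \<in> prime_H H W T1 T2. \<psi> v = 0})"

definition closed_H :: "('k::field, 'l::ab_group_add, 'v::ab_group_add) rep \<Rightarrow> obj
    \<Rightarrow> ((nat list \<Rightarrow> 'k) set \<times> (nat list \<times> nat \<Rightarrow> 'k) set) set" where
  "closed_H H W = {(T1, T2). T1 \<subseteq> Lfree (fst W) \<and> T2 \<subseteq> AYfree (fst W) (snd W)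
                     \<and> dprime_H H W T1 T2 = (T1, T2)}"

definition geom_equiv :: "('k::field, 'l1::ab_group_add, 'v1::ab_group_add) rep
    \<Rightarrow> ('k, 'l2::ab_group_add, 'v2::ab_group_add) rep \<Rightarrow> bool" where
  "geom_equiv H1 H2 \<longleftrightarrow> (\<forall>W\<in>Ob. \<forall>T1 T2. T1 \<subseteq> Lfree (fst W) \<longrightarrow> T2 \<subseteq> AYfree (fst W) (snd W)
       \<longrightarrow> dprime_H H1 W T1 T2 = dprime_H H2 W T1 T2)"

definition beta :: "obj \<Rightarrow> obj \<Rightarrow> (nat list \<Rightarrow> 'k::field) set \<times> (nat list \<times> nat \<Rightarrow> 'k) set
    \<Rightarrow> ((((nat list \<Rightarrow> 'k) \<Rightarrow> (nat list \<Rightarrow> 'k)) \<times> ((nat list \<times> nat \<Rightarrow> 'k) \<Rightarrow> (nat list \<times> nat \<Rightarrow> 'k)))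
       \<times> (((nat list \<Rightarrow> 'k) \<Rightarrow> (nat list \<Rightarrow> 'k)) \<times> ((nat list \<times> nat \<Rightarrow> 'k) \<Rightarrow> (nat list \<times> nat \<Rightarrow> 'k)))) set" where
  "beta W1 W2 T = {(f, g). f \<in> homW W1 W2 \<and> g \<in> homW W1 W2
      \<and> (\<forall>l\<in>Lfree (fst W1). fst f l - fst g l \<in> fst T)
      \<and> (\<forall>v\<in>AYfree (fst W1) (snd W1). snd f v - snd g v \<in> snd T)}"

definition auto_equiv :: "('k::field, 'l1::ab_group_add, 'v1::ab_group_add) rep
    \<Rightarrow> ('k, 'l2::ab_group_add, 'v2::ab_group_add) rep \<Rightarrow> bool" where
  "auto_equiv H1 H2 \<longleftrightarrow> (\<exists>Fo Fm \<alpha>. cat_auto Fo Fm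
     \<and> (\<forall>W\<in>Ob. bij_betw (\<alpha> W) (closed_H H1 W) (closed_H H2 (Fo W)))
     \<and> (\<forall>W1\<in>Ob. \<forall>W2\<in>Ob. \<forall>T\<in>closed_H H1 W2.
          (\<lambda>(f, g). (Fm W1 W2 f, Fm W1 W2 g)) ` beta W1 W2 T
            = beta (Fo W1) (Fo W2) (\<alpha> W2 T)))"

end

theory Submission
  imports Defs
begin

text \<open>Elements of L(X) and of A(X)Y are the morphisms into W(X,Y) from the rank-one objects
  W(x,-) and W(-,y). These two objects are the only nonzero ones with a commutative endomorphism
  monoid, and an automorphism of the category cannot exchange them; it therefore acts on elements
  through bijections s and t that are natural in W(X,Y). The operations of W(X,Y) transported along
  s and t are again natural, hence given by elements of free objects, and homogeneity determines
  these elements: addition is preserved, scalars are twisted by an automorphism of the field (so not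
  at all), and the bracket and the action are both multiplied by one nonzero constant c. After
  dividing s by c, the pair (s,t) is an isomorphism from W to its image. The condition on the
  relations beta says that the bijections of closed pairs are induced by these isomorphisms, and
  closedness is invariant under isomorphism; so H1 and H2 have the same closed pairs.\<close>

text \<open>Homogeneity is tested with diagonal endomorphisms: multiplying every letter by 2
  multiplies the coefficient of a word of length n by 2^n, and in characteristic 0 the equation 2^n
  = 2 leaves only n = 1. Additivity has to be obtained before the twist on scalars is known to be
  trivial; this works because the unknown factor appears on both sides of the comparison. Both
  rank-one objects have the multiplicative monoid of k as endomorphism monoid, so a further object
  is needed to tell them apart. One constant serves the bracket and the action because [a,b]m =
  a(bm) - b(am) compares the two constants wherever [a,b]m is nonzero. The relation
  \<open>beta\<close> is evaluated on sources of rank one, where two morphisms are related exactly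
  when the difference of the elements they pick out lies in the closed pair. Since the automorphism
  may move objects, this describes closed pairs in the image of W, and the inverse isomorphism
  brings them back to W.\<close>

definition mon :: "'a \<Rightarrow> 'a \<Rightarrow> 'k::field" where
  "mon z = (\<lambda>u. if u = z then 1 else 0)"

lemma pgen_eq_mon: "pgen x = mon [x]"
  by (simp add: pgen_def mon_def)

lemma psc_simps [simp]:
  "psc c 0 = 0" "psc 0 p = 0" "psc 1 p = p" "psc c (psc d p) = psc (c * d) p"
  by (auto simp: psc_def fun_eq_iff)

lemma psc_add: "psc c (p + q) = psc c p + psc c q"
  and psc_diff: "psc c (p - q) = psc c p - psc c q"
  and psc_add_left: "psc (c + d) p = psc c p + psc d p"
  by (auto simp: psc_def fun_eq_iff algebra_simps)

lemma psc_uminus: "psc (- 1) p = - p"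
  by (auto simp: psc_def fun_eq_iff)

lemma psc_apply: "psc c p z = c * p z"
  by (simp add: psc_def)

section \<open>Product of noncommutative polynomials and action on the free module\<close>

lemma pmul_Nil [simp]: "pmul p q [] = p [] * q []"
  by (simp add: pmul_def)

text \<open>Apart from the cut in front of the first letter, the cuts of \<open>x # w\<close> are
  those of \<open>w\<close>, with the left factor replaced by its left quotient by \<open>x\<close>.
  This recursion turns statements about \<open>pmul\<close> into inductions on the word with an
  arbitrary left factor.\<close>

lemma pmul_Cons [simp]: "pmul p q (x # w) = p [] * q (x # w) + pmul (\<lambda>u. p (x # u)) q w"
  by (simp add: pmul_def sum.atMost_Suc_shift del: sum.atMost_Suc)

lemma pmul_zero [simp]: "pmul 0 q = 0" "pmul p 0 = 0"
  by (auto simp: pmul_def fun_eq_iff)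

lemma pmul_add_left: "pmul (p + p') q = pmul p q + pmul p' q"
  and pmul_add_right: "pmul p (q + q') = pmul p q + pmul p q'"
  and pmul_psc_left [simp]: "pmul (psc c p) q = psc c (pmul p q)"
  and pmul_psc_right [simp]: "pmul p (psc c q) = psc c (pmul p q)"
  by (auto simp: pmul_def psc_def fun_eq_iff sum.distrib sum_distrib_left algebra_simps)

text \<open>The left quotients produced by \<open>pmul_Cons\<close> appear as lambda terms, which
  the pointfree rules do not match.\<close>

lemma pmul_add_left': "pmul (\<lambda>u. p u + p' u) q w = pmul p q w + pmul p' q w"
  using fun_cong[OF pmul_add_left[of p p' q], of w] by (simp add: plus_fun_def)

lemma pmul_psc_left': "pmul (\<lambda>u. c * p u) q w = c * pmul p q w"
  using fun_cong[OF pmul_psc_left[of c p q], of w] by (simp add: psc_def)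

lemma pmul_assoc: "pmul (pmul p q) r = pmul p (pmul q r)"
proof
  show "pmul (pmul p q) r w = pmul p (pmul q r) w" for w
    by (induction w arbitrary: p)
      (simp_all add: pmul_add_left' pmul_psc_left' algebra_simps)
qed

lemma pmul_mon: "pmul (mon u) (mon v) = (mon (u @ v) :: nat list \<Rightarrow> 'k::field)"
proof
  show "pmul (mon u) (mon v) w = (mon (u @ v) w :: 'k)" for w
  proof (induction w arbitrary: u)
    case Nil
    then show ?case by (auto simp: mon_def)
  next
    case (Cons x w)
    show ?case
    proof (cases u)
      case Nil
      have "(\<lambda>u. mon [] (x # u)) = (0 :: nat list \<Rightarrow> 'k)"
        by (auto simp: mon_def fun_eq_iff)
      then have "pmul (\<lambda>u. mon [] (x # u)) (mon v) w = (0 :: 'k)" by simp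
      moreover have "mon ([] :: nat list) [] = (1 :: 'k)" by (simp add: mon_def)
      ultimately show ?thesis using Nil by simp
    next
      case (Cons y u')
      have "(\<lambda>v. mon (y # u') (x # v)) = (if x = y then mon u' else (0 :: nat list \<Rightarrow> 'k))"
        by (auto simp: mon_def fun_eq_iff)
      moreover have "mon (y # u') ([] :: nat list) = (0 :: 'k)" by (simp add: mon_def)
      ultimately show ?thesis using Cons.IH[of u'] Cons
        by (auto simp: mon_def)
    qed
  qed
qed

lemma pmul_one [simp]: "pmul (mon []) p = p" "pmul p (mon []) = p"
  for p :: "nat list \<Rightarrow> 'k::field"
proof -
  have "(\<lambda>u. mon [] (x # u)) = (0 :: nat list \<Rightarrow> 'k)" for x
    by (auto simp: mon_def fun_eq_iff)
  then have "pmul (mon []) p w = p w" for w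
    by (cases w) (simp_all, simp_all add: mon_def)
  then show "pmul (mon []) p = p" by auto
  have "pmul p (mon []) w = p w" for w
    by (induction w arbitrary: p) (auto simp: mon_def)
  then show "pmul p (mon []) = p" by auto
qed

text \<open>For fixed \<open>y\<close> the action is the product with the component at
  \<open>y\<close>: the free module is a direct sum of copies of A(X), so its laws are inherited
  from \<open>pmul\<close>.\<close>

lemma pact_eq_pmul: "pact p m (w, y) = pmul p (\<lambda>u. m (u, y)) w"
  by (simp add: pact_def pmul_def)

lemma pact_pmul: "pact (pmul p q) m = pact p (pact q m)"
  by (auto simp: fun_eq_iff pact_eq_pmul pmul_assoc)

lemma pact_add_left: "pact (p + p') m = pact p m + pact p' m"
  and pact_add_right: "pact p (m + m') = pact p m + pact p m'"
  and pact_psc_left [simp]: "pact (psc c p) m = psc c (pact p m)"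
  and pact_psc_right [simp]: "pact p (psc c m) = psc c (pact p m)"
  and pact_zero [simp]: "pact 0 m = 0" "pact p 0 = 0"
  by (auto simp: pact_def psc_def fun_eq_iff sum.distrib sum_distrib_left algebra_simps)

lemma pact_diff_left: "pact (p - p') m = pact p m - pact p' m"
  by (auto simp: pact_def fun_eq_iff sum_subtractf algebra_simps)

lemma pact_mon: "pact (mon u) (mon (v, y)) = (mon (u @ v, y) :: nat list \<times> nat \<Rightarrow> 'k::field)"
proof -
  have eq: "(\<lambda>u. mon (v, y) (u, z)) = (if z = y then mon v else (0 :: nat list \<Rightarrow> 'k))" for z
    by (auto simp: mon_def fun_eq_iff)
  show ?thesis
    by (auto simp: fun_eq_iff pact_eq_pmul eq pmul_mon) (auto simp: mon_def)
qed

lemma pact_one [simp]: "pact (mon []) m = m"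
  by (auto simp: fun_eq_iff pact_eq_pmul)

lemma pbr_zero [simp]: "pbr 0 q = 0" "pbr p 0 = 0"
  and pbr_self [simp]: "pbr p p = 0"
  and pbr_psc_left [simp]: "pbr (psc c p) q = psc c (pbr p q)"
  and pbr_psc_right [simp]: "pbr p (psc c q) = psc c (pbr p q)"
  by (auto simp: pbr_def psc_diff)

lemma pact_pbr: "pact (pbr p q) m = pact p (pact q m) - pact q (pact p m)"
  by (simp add: pbr_def pact_diff_left pact_pmul)

section \<open>Linear extension from monomials\<close>

text \<open>On finitely supported functions this is the linear map with values \<open>F\<close> on
  monomials. For infinite support the sum is 0 by convention, which is why linearity is stated for
  finite supports.\<close>

definition lext :: "('a \<Rightarrow> 'b \<Rightarrow> 'k::field) \<Rightarrow> ('a \<Rightarrow> 'k) \<Rightarrow> 'b \<Rightarrow> 'k" where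
  "lext F p = (\<Sum>z | p z \<noteq> 0. psc (p z) (F z))"

lemma sum_fun_apply: "sum f A z = (\<Sum>x\<in>A. f x z)"
  for f :: "'a \<Rightarrow> 'b \<Rightarrow> 'c::comm_monoid_add"
  by (induction A rule: infinite_finite_induct) auto

lemma lext_superset:
  assumes "finite S" "{z. p z \<noteq> 0} \<subseteq> S"
  shows "lext F p = (\<Sum>z\<in>S. psc (p z) (F z))"
  unfolding lext_def by (rule sum.mono_neutral_left) (use assms in auto)

lemma lext_add:
  assumes "finite {z. p z \<noteq> 0}" "finite {z. q z \<noteq> 0}"
  shows "lext F (p + q) = lext F p + lext F q"
proof -
  let ?S = "{z. p z \<noteq> 0} \<union> {z. q z \<noteq> 0}"
  have "finite ?S" using assms by simp
  then show ?thesis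
    by (subst (1 2 3) lext_superset[where S = ?S])
      (auto simp: psc_add_left sum.distrib)
qed

lemma lext_psc:
  assumes "finite {z. p z \<noteq> 0}"
  shows "lext F (psc c p) = psc c (lext F p)"
proof -
  have "psc c (\<Sum>z\<in>S. psc (p z) (F z)) = (\<Sum>z\<in>S. psc c (psc (p z) (F z)))" for S
    by (auto simp: fun_eq_iff psc_def sum_fun_apply sum_distrib_left)
  then show ?thesis using assms
    by (subst (1 2) lext_superset[where S = "{z. p z \<noteq> 0}"]) (auto simp: psc_apply)
qed

lemma lext_mon [simp]: "lext F (mon z) = F z"
  by (subst lext_superset[where S = "{z}"]) (auto simp: mon_def)

lemma lext_zero [simp]: "lext F 0 = 0"
  by (simp add: lext_def)

text \<open>A finitely supported function is the sum of its monomials, and partial sums stay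
  finitely supported. The monomial case keeps \<open>p z \<noteq> 0\<close>, so that restrictions on
  the letters of \<open>p\<close> reach the monomials in the rules derived from this one.\<close>

lemma finite_support_induct [consumes 1, case_names zero mon add]:
  fixes p :: "'a \<Rightarrow> 'k::field"
  assumes "finite {z. p z \<noteq> 0}"
    and zero: "P 0"
    and mon: "\<And>c z. p z \<noteq> 0 \<Longrightarrow> P (psc c (mon z))"
    and add: "\<And>q r. finite {z. q z \<noteq> 0} \<Longrightarrow> finite {z. r z \<noteq> 0} \<Longrightarrow> P q \<Longrightarrow> P r \<Longrightarrow> P (q + r)"
  shows "P p"
proof -
  have fm: "finite {z'. psc c (mon z) z' \<noteq> 0}" for c and z :: 'a
    by (rule finite_subset[of _ "{z}"]) (auto simp: psc_def mon_def)
  have fs: "finite {z. (\<Sum>u\<in>S. psc (p u) (mon u)) z \<noteq> 0}" if "finite S" for S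
    using that
  proof induction
    case (insert x S)
    show ?case
      by (rule finite_subset[OF _ finite_UnI[OF fm insert.IH, of "p x" x]])
        (use insert in auto)
  qed auto
  have "P (\<Sum>z\<in>S. psc (p z) (mon z))" if "finite S" "S \<subseteq> {z. p z \<noteq> 0}" for S
    using that by induction (auto intro!: zero mon add fm fs)
  moreover have "p = (\<Sum>z | p z \<noteq> 0. psc (p z) (mon z))"
  proof
    show "p w = (\<Sum>z | p z \<noteq> 0. psc (p z) (mon z)) w" for w
      using assms(1) by (simp add: sum_fun_apply psc_def mon_def sum.delta' if_distrib cong: if_cong)
  qed
  ultimately show ?thesis using assms(1) by (metis order_refl)
qed

section \<open>Closure properties of the free algebra, module and Lie algebra\<close>

definition ygen :: "nat \<Rightarrow> nat list \<times> nat \<Rightarrow> 'k::field" where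
  "ygen y = mon ([], y)"

lemma mon_self [simp]: "mon z z = 1"
  by (simp add: mon_def)

lemma mon_nonzero [simp]: "mon z \<noteq> 0" "pgen x \<noteq> 0" "ygen y \<noteq> 0"
  by (metis mon_self zero_fun_apply zero_neq_one pgen_eq_mon ygen_def)+

lemma finite_support_add:
  fixes p q :: "'a \<Rightarrow> 'k::field"
  shows "finite {z. p z \<noteq> 0} \<Longrightarrow> finite {z. q z \<noteq> 0} \<Longrightarrow> finite {z. (p + q) z \<noteq> 0}"
  by (rule finite_subset[of _ "{z. p z \<noteq> 0} \<union> {z. q z \<noteq> 0}"]) auto

lemma finite_support_psc:
  fixes p :: "'a \<Rightarrow> 'k::field"
  shows "finite {z. p z \<noteq> 0} \<Longrightarrow> finite {z. psc c p z \<noteq> 0}"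
  by (rule finite_subset[of _ "{z. p z \<noteq> 0}"]) (auto simp: psc_def)

lemma Afree_zero [simp]: "0 \<in> Afree X"
  by (simp add: Afree_def)

lemma Afree_mon [simp]: "(mon w :: _ \<Rightarrow> 'k::field) \<in> Afree X \<longleftrightarrow> set w \<subseteq> X"
  by (auto simp: Afree_def mon_def)

lemma Afree_add: "p \<in> Afree X \<Longrightarrow> q \<in> Afree X \<Longrightarrow> p + q \<in> Afree X"
  unfolding Afree_def using finite_support_add[of p q] by (auto, force)

lemma Afree_psc: "p \<in> Afree X \<Longrightarrow> psc c p \<in> Afree X"
  unfolding Afree_def using finite_support_psc[of p c] by (auto simp: psc_apply)

lemma AYfree_zero [simp]: "0 \<in> AYfree X Y"
  by (simp add: AYfree_def)

lemma AYfree_mon [simp]: "(mon (w, y) :: _ \<Rightarrow> 'k::field) \<in> AYfree X Y \<longleftrightarrow> set w \<subseteq> X \<and> y \<in> Y"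
  by (auto simp: AYfree_def mon_def)

lemma AYfree_ygen [simp]: "(ygen y :: _ \<Rightarrow> 'k::field) \<in> AYfree X Y \<longleftrightarrow> y \<in> Y"
  by (simp add: ygen_def)

lemma AYfree_add: "p \<in> AYfree X Y \<Longrightarrow> q \<in> AYfree X Y \<Longrightarrow> p + q \<in> AYfree X Y"
  unfolding AYfree_def using finite_support_add[of p q] by simp (metis add.right_neutral)

lemma AYfree_psc: "p \<in> AYfree X Y \<Longrightarrow> psc c p \<in> AYfree X Y"
  unfolding AYfree_def using finite_support_psc[of p c] by (auto simp: psc_apply)

text \<open>The induction rules below produce eta-expanded goals, inside which these rewrite rules would
  unfold sums and zeros of functions.\<close>

declare plus_fun_apply [simp del] zero_fun_apply [simp del] minus_apply [simp del] uminus_apply [simp del]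

lemma Afree_induct [consumes 1, case_names zero mon add]:
  assumes "p \<in> Afree X"
    and "P 0"
    and "\<And>c w. set w \<subseteq> X \<Longrightarrow> P (psc c (mon w))"
    and add: "\<And>q r. q \<in> Afree X \<Longrightarrow> r \<in> Afree X \<Longrightarrow> P q \<Longrightarrow> P r \<Longrightarrow> P (q + r)"
  shows "P p"
proof -
  have "finite {z. p z \<noteq> 0}" using assms(1) by (simp add: Afree_def)
  \<comment> \<open>Membership is carried along because the underlying rule offers only finite
    support for the summands, while the case \<open>add\<close> asks for their membership.\<close>
  then have "p \<in> Afree X \<and> P p"
  proof (induction rule: finite_support_induct)
    case (mon c z)
    then have "set z \<subseteq> X" using assms(1) by (simp add: Afree_def)
    then show ?case using assms(3) by (simp add: Afree_psc)
  next
    case zero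
    show ?case using assms(2) by simp
  next
    case (add q r)
    then show ?case using assms(4) Afree_add by blast
  qed
  then show ?thesis ..
qed

lemma AYfree_induct [consumes 1, case_names zero mon add]:
  assumes "p \<in> AYfree X Y"
    and "P 0"
    and "\<And>c w y. set w \<subseteq> X \<Longrightarrow> y \<in> Y \<Longrightarrow> P (psc c (mon (w, y)))"
    and add: "\<And>q r. q \<in> AYfree X Y \<Longrightarrow> r \<in> AYfree X Y \<Longrightarrow> P q \<Longrightarrow> P r \<Longrightarrow> P (q + r)"
  shows "P p"
proof -
  have "finite {z. p z \<noteq> 0}" using assms(1) by (simp add: AYfree_def)
  then have "p \<in> AYfree X Y \<and> P p"
  proof (induction rule: finite_support_induct)
    case (mon c z)
    then have "set (fst z) \<subseteq> X \<and> snd z \<in> Y" using assms(1) by (cases z) (simp add: AYfree_def)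
    then show ?case using assms(3) by (cases z) (simp add: AYfree_psc)
  next
    case zero
    show ?case using assms(2) by simp
  next
    case (add q r)
    then show ?case using assms(4) AYfree_add by blast
  qed
  then show ?thesis ..
qed

lemma Afree_pmul:
  assumes p: "p \<in> Afree X" and q: "q \<in> Afree X"
  shows "pmul p q \<in> Afree X"
  using p
proof (induction rule: Afree_induct)
  case (mon c w)
  show ?case using q mon
    by (induction rule: Afree_induct)
      (auto simp: pmul_mon pmul_add_right psc_add intro!: Afree_psc Afree_add)
qed (auto simp: pmul_add_left Afree_add)

lemma AYfree_pact:
  assumes p: "p \<in> Afree X" and q: "q \<in> AYfree X Y"
  shows "pact p q \<in> AYfree X Y"
  using p
proof (induction rule: Afree_induct)
  case (mon c w)
  show ?case using q mon
    by (induction rule: AYfree_induct)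
      (auto simp: pact_mon pact_add_right psc_add intro!: AYfree_psc AYfree_add)
qed (auto simp: pact_add_left AYfree_add)

lemma Lfree_subset_Afree: "p \<in> Lfree X \<Longrightarrow> p \<in> Afree X"
proof (induction rule: Lfree.induct)
  case (br p q)
  have "pbr p q = pmul p q + psc (- 1) (pmul q p)"
    by (simp add: pbr_def psc_uminus)
  then show ?case using br by (simp add: Afree_pmul Afree_psc Afree_add)
qed (auto simp: pgen_eq_mon Afree_add Afree_psc)

lemma Lfree_finite: "p \<in> Lfree X \<Longrightarrow> finite {z. p z \<noteq> 0}"
  and Afree_finite: "p \<in> Afree X \<Longrightarrow> finite {z. p z \<noteq> 0}"
  and AYfree_finite: "m \<in> AYfree X Y \<Longrightarrow> finite {z. m z \<noteq> 0}"
  using Lfree_subset_Afree[of p X] by (auto simp: Afree_def AYfree_def)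

lemma Lfree_support: "p \<in> Lfree X \<Longrightarrow> p w \<noteq> 0 \<Longrightarrow> set w \<subseteq> X"
  using Lfree_subset_Afree[of p X] by (auto simp: Afree_def)

lemma AYfree_pact_Lfree: "p \<in> Lfree X \<Longrightarrow> q \<in> AYfree X Y \<Longrightarrow> pact p q \<in> AYfree X Y"
  by (simp add: AYfree_pact Lfree_subset_Afree)

section \<open>Homomorphisms\<close>

lemma hom_genD:
  assumes "h \<in> hom_gen X Y CL CV sL bL sV act"
  shows hom_fst_add: "p \<in> Lfree X \<Longrightarrow> q \<in> Lfree X \<Longrightarrow> fst h (p + q) = fst h p + fst h q"
    and hom_fst_br: "p \<in> Lfree X \<Longrightarrow> q \<in> Lfree X \<Longrightarrow> fst h (pbr p q) = bL (fst h p) (fst h q)"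
    and hom_fst_psc: "p \<in> Lfree X \<Longrightarrow> fst h (psc c p) = sL c (fst h p)"
    and hom_snd_add: "u \<in> AYfree X Y \<Longrightarrow> v \<in> AYfree X Y \<Longrightarrow> snd h (u + v) = snd h u + snd h v"
    and hom_snd_psc: "u \<in> AYfree X Y \<Longrightarrow> snd h (psc c u) = sV c (snd h u)"
    and hom_snd_pact: "p \<in> Lfree X \<Longrightarrow> u \<in> AYfree X Y \<Longrightarrow> snd h (pact p u) = act (fst h p) (snd h u)"
    and hom_fst_in: "p \<in> Lfree X \<Longrightarrow> fst h p \<in> CL"
    and hom_snd_in: "u \<in> AYfree X Y \<Longrightarrow> snd h u \<in> CV"
    and hom_fst_ext: "fst h \<in> extensional (Lfree X)"
    and hom_snd_ext: "snd h \<in> extensional (AYfree X Y)"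
  using assms by (auto simp: hom_gen_def)

lemma hom_gen_zero:
  fixes sL :: "'k::field \<Rightarrow> 'l::ab_group_add \<Rightarrow> 'l" and sV :: "'k::field \<Rightarrow> 'v::ab_group_add \<Rightarrow> 'v"
  assumes "h \<in> hom_gen X Y CL CV sL bL sV act"
  shows "fst h 0 = 0" "snd h 0 = 0"
  using hom_fst_add[OF assms Lfree.zero Lfree.zero] hom_snd_add[OF assms, of 0 0] by auto

text \<open>Agreement spreads from the letters to L(X) by induction on Lie generation, and from
  \<open>ygen y\<close> to \<open>mon (w, y)\<close> one letter at a time through the action.
  Extensionality turns agreement on the carriers into equality.\<close>

lemma hom_gen_eqI:
  fixes sL :: "'k::field \<Rightarrow> 'l::ab_group_add \<Rightarrow> 'l" and sV :: "'k::field \<Rightarrow> 'v::ab_group_add \<Rightarrow> 'v"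
  assumes f: "f \<in> hom_gen X Y CL CV sL bL sV act" and g: "g \<in> hom_gen X Y CL' CV' sL bL sV act"
    and x: "\<And>x. x \<in> X \<Longrightarrow> fst f (pgen x) = fst g (pgen x)"
    and y: "\<And>y. y \<in> Y \<Longrightarrow> snd f (ygen y) = snd g (ygen y)"
  shows "f = g"
proof -
  have L: "fst f p = fst g p" if "p \<in> Lfree X" for p
    using that
    by induction
      (simp_all add: hom_gen_zero[OF f] hom_gen_zero[OF g] x hom_fst_add[OF f] hom_fst_add[OF g]
        hom_fst_psc[OF f] hom_fst_psc[OF g] hom_fst_br[OF f] hom_fst_br[OF g])
  have M: "snd f (mon (w, z)) = snd g (mon (w, z))" if "set w \<subseteq> X" "z \<in> Y" for w z
    using that
  proof (induction w)
    case Nil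
    then show ?case using y by (simp add: ygen_def)
  next
    case (Cons a w)
    have "(mon (a # w, z) :: _ \<Rightarrow> 'k) = pact (pgen a) (mon (w, z))"
      by (simp add: pgen_eq_mon pact_mon)
    then show ?case using Cons
      by (simp add: hom_snd_pact[OF f] hom_snd_pact[OF g] L Lfree.gen)
  qed
  have V: "snd f m = snd g m" if "m \<in> AYfree X Y" for m
    using that
    by (induction rule: AYfree_induct)
      (simp_all add: hom_gen_zero[OF f] hom_gen_zero[OF g] hom_snd_add[OF f] hom_snd_add[OF g]
        hom_snd_psc[OF f] hom_snd_psc[OF g] M)
  show ?thesis
    using extensionalityI[OF hom_fst_ext[OF f] hom_fst_ext[OF g] L]
      extensionalityI[OF hom_snd_ext[OF f] hom_snd_ext[OF g] V] by (simp add: prod_eq_iff)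
qed

section \<open>Substitution and the universal property of the free representation\<close>

fun wprod :: "(nat \<Rightarrow> nat list \<Rightarrow> 'k::field) \<Rightarrow> nat list \<Rightarrow> nat list \<Rightarrow> 'k" where
  "wprod a [] = mon []"
| "wprod a (x # w) = pmul (a x) (wprod a w)"

lemma wprod_append: "wprod a (u @ w) = pmul (wprod a u) (wprod a w)"
  by (induction u) (simp_all add: pmul_assoc)

text \<open>The associative substitution sending each letter \<open>x\<close> to \<open>a x\<close>.
  As L(X) is realised inside A(X), restricting it yields the Lie homomorphism with these values on
  the letters.\<close>

definition subst_A :: "(nat \<Rightarrow> nat list \<Rightarrow> 'k::field) \<Rightarrow> (nat list \<Rightarrow> 'k) \<Rightarrow> nat list \<Rightarrow> 'k" where
  "subst_A a = lext (wprod a)"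

definition subst_M :: "(nat \<Rightarrow> nat list \<Rightarrow> 'k::field) \<Rightarrow> (nat \<Rightarrow> nat list \<times> nat \<Rightarrow> 'k)
    \<Rightarrow> (nat list \<times> nat \<Rightarrow> 'k) \<Rightarrow> nat list \<times> nat \<Rightarrow> 'k" where
  "subst_M a v = lext (\<lambda>(w, y). pact (wprod a w) (v y))"

lemma subst_A_pmul:
  assumes p: "p \<in> Afree X" and q: "q \<in> Afree X"
  shows "subst_A a (pmul p q) = pmul (subst_A a p) (subst_A a q)"
  using p
proof (induction rule: Afree_induct)
  case (mon c w)
  have fm: "finite {z. mon w z \<noteq> (0::'a)}" for w :: "nat list"
    by (simp add: mon_def)
  have "subst_A a (pmul (mon w) q) = pmul (subst_A a (mon w)) (subst_A a q)"
    using q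
  proof (induction rule: Afree_induct)
    case (mon d u)
    then show ?case
      by (simp add: subst_A_def pmul_mon lext_psc fm wprod_append)
  next
    case (add q r)
    then show ?case using mon
      by (simp add: pmul_add_right subst_A_def lext_add Afree_finite[of _ X] Afree_pmul)
  qed (simp add: subst_A_def)
  then show ?case using Afree_finite[OF Afree_pmul[OF _ q]] mon
    by (simp add: subst_A_def lext_psc fm)
next
  case (add p r)
  then show ?case using q
    by (simp add: pmul_add_left subst_A_def lext_add Afree_finite[of _ X] Afree_pmul)
qed (simp add: subst_A_def)

lemma subst_M_pact:
  assumes p: "p \<in> Afree X" and q: "q \<in> AYfree X Y"
  shows "subst_M a v (pact p q) = pact (subst_A a p) (subst_M a v q)"
  using p
proof (induction rule: Afree_induct)
  case (mon c w)
  have fm: "finite {z. mon w z \<noteq> (0::'a)}" for w :: 'c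
    by (simp add: mon_def)
  have "subst_M a v (pact (mon w) q) = pact (subst_A a (mon w)) (subst_M a v q)"
    using q
  proof (induction rule: AYfree_induct)
    case (mon d u y)
    then show ?case
      by (simp add: subst_A_def subst_M_def pact_mon lext_psc fm wprod_append pact_pmul)
  next
    case (add q r)
    then show ?case using mon
      by (simp add: pact_add_right subst_A_def subst_M_def lext_add AYfree_finite[of _ X Y] AYfree_pact)
  qed (simp add: subst_M_def)
  then show ?case using AYfree_finite[OF AYfree_pact[OF _ q]] mon
    by (simp add: subst_A_def subst_M_def lext_psc fm)
next
  case (add p r)
  then show ?case using q
    by (simp add: pact_add_left subst_A_def subst_M_def lext_add Afree_finite[of _ X] AYfree_finite[of _ X Y] AYfree_pact)
qed (simp add: subst_A_def subst_M_def)

lemma subst_A_pgen [simp]: "subst_A a (pgen x) = a x"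
  by (simp add: subst_A_def pgen_eq_mon)

lemma subst_M_ygen [simp]: "subst_M a v (ygen y) = v y"
  by (simp add: subst_M_def ygen_def)

lemma subst_A_br:
  assumes "p \<in> Lfree X" "q \<in> Lfree X"
  shows "subst_A a (pbr p q) = pbr (subst_A a p) (subst_A a q)"
proof -
  have A: "p \<in> Afree X" "q \<in> Afree X" using assms by (auto simp: Lfree_subset_Afree)
  \<comment> \<open>The difference is recast as a sum with scalar -1, the form in which linearity of
    \<open>lext\<close> is available.\<close>
  have eq: "pbr p q = pmul p q + psc (- 1) (pmul q p)" for p q :: "nat list \<Rightarrow> 'a"
    by (simp add: pbr_def psc_uminus)
  have "subst_A a (pbr p q) = subst_A a (pmul p q) + psc (- 1) (subst_A a (pmul q p))"
    unfolding eq subst_A_def using A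
    by (subst lext_add) (auto simp: lext_psc Afree_finite[of _ X] Afree_pmul Afree_psc)
  then show ?thesis using A by (simp add: eq subst_A_pmul)
qed

lemma subst_A_Lfree:
  assumes a: "\<And>x. x \<in> X \<Longrightarrow> a x \<in> Lfree X'" and p: "p \<in> Lfree X"
  shows "subst_A a p \<in> Lfree X'"
  using p
proof induction
  case (br p q)
  then show ?case by (simp add: subst_A_br Lfree.br)
qed (auto simp: subst_A_def lext_add lext_psc Lfree_finite[of _ X] pgen_eq_mon a Lfree.zero Lfree.add Lfree.smul)

lemma wprod_Afree: "(\<And>x. x \<in> X \<Longrightarrow> a x \<in> Lfree X') \<Longrightarrow> set w \<subseteq> X \<Longrightarrow> wprod a w \<in> Afree X'"
  by (induction w) (auto intro: Afree_pmul Lfree_subset_Afree)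

lemma subst_M_AYfree:
  assumes a: "\<And>x. x \<in> X \<Longrightarrow> a x \<in> Lfree X'" and v: "\<And>y. y \<in> Y \<Longrightarrow> v y \<in> AYfree X' Y'"
    and p: "p \<in> AYfree X Y"
  shows "subst_M a v p \<in> AYfree X' Y'"
  using p
proof (induction rule: AYfree_induct)
  case (mon c w y)
  have "finite {z. mon (w, y) z \<noteq> (0::'a)}" by (simp add: mon_def)
  moreover have "wprod a w \<in> Afree X'" by (rule wprod_Afree[of X]) (use mon a in auto)
  moreover have "v y \<in> AYfree X' Y'" using mon v by simp
  ultimately show ?case
    by (simp add: subst_M_def lext_psc AYfree_psc AYfree_pact)
qed (auto simp: subst_M_def lext_add AYfree_finite[of _ X Y] AYfree_add)

type_synonym 'k whom =
  "((nat list \<Rightarrow> 'k) \<Rightarrow> (nat list \<Rightarrow> 'k)) \<times>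
    ((nat list \<times> nat \<Rightarrow> 'k) \<Rightarrow> (nat list \<times> nat \<Rightarrow> 'k))"

text \<open>The existence half of freeness. Restriction to the carriers makes the pair extensional,
  so that \<open>hom_gen_eqI\<close> supplies uniqueness.\<close>

definition sub :: "obj \<Rightarrow> (nat \<Rightarrow> nat list \<Rightarrow> 'k::field) \<Rightarrow> (nat \<Rightarrow> nat list \<times> nat \<Rightarrow> 'k)
    \<Rightarrow> 'k whom" where
  "sub A a v = (restrict (subst_A a) (Lfree (fst A)), restrict (subst_M a v) (AYfree (fst A) (snd A)))"

lemma sub_hom:
  assumes "\<And>x. x \<in> fst A \<Longrightarrow> a x \<in> Lfree (fst B)"
    and "\<And>y. y \<in> snd A \<Longrightarrow> v y \<in> AYfree (fst B) (snd B)"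
  shows "sub A a v \<in> homW A B"
proof -
  have A: "subst_A a p \<in> Lfree (fst B)" if "p \<in> Lfree (fst A)" for p
    using subst_A_Lfree[OF assms(1) that] .
  have M: "subst_M a v m \<in> AYfree (fst B) (snd B)" if "m \<in> AYfree (fst A) (snd A)" for m
    using subst_M_AYfree[OF assms that] .
  have "subst_A a (p + q) = subst_A a p + subst_A a q" "subst_A a (psc c p) = psc c (subst_A a p)"
    if "p \<in> Lfree (fst A)" "q \<in> Lfree (fst A)" for p q c
    using that by (auto simp: subst_A_def lext_add lext_psc Lfree_finite[of _ "fst A"])
  moreover have "subst_M a v (p + q) = subst_M a v p + subst_M a v q"
    "subst_M a v (psc c p) = psc c (subst_M a v p)"
    if "p \<in> AYfree (fst A) (snd A)" "q \<in> AYfree (fst A) (snd A)" for p q c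
    using that by (auto simp: subst_M_def lext_add lext_psc AYfree_finite[of _ "fst A" "snd A"])
  ultimately show ?thesis
    unfolding sub_def homW_def hom_gen_def
    by (auto simp: subst_A_br Lfree.intros AYfree_add AYfree_psc AYfree_pact_Lfree A M
        subst_M_pact[OF Lfree_subset_Afree])
qed

lemma sub_gen:
  "x \<in> fst A \<Longrightarrow> fst (sub A a v) (pgen x) = a x"
  "y \<in> snd A \<Longrightarrow> snd (sub A a v) (ygen y) = v y"
  by (auto simp: sub_def Lfree.gen)

lemma homW_eqI:
  assumes "f \<in> homW A B" "g \<in> homW A B"
    and "\<And>x. x \<in> fst A \<Longrightarrow> fst f (pgen x) = fst g (pgen x)"
    and "\<And>y. y \<in> snd A \<Longrightarrow> snd f (ygen y) = snd g (ygen y)"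
  shows "f = g"
  using assms hom_gen_eqI unfolding homW_def by metis

lemma compW_gen:
  "p \<in> Lfree (fst A) \<Longrightarrow> fst (compW A g f) p = fst g (fst f p)"
  "m \<in> AYfree (fst A) (snd A) \<Longrightarrow> snd (compW A g f) m = snd g (snd f m)"
  by (auto simp: compW_def)

text \<open>The type of compW only allows targets in the category; here the target can be any representation.\<close>

definition compG :: "obj \<Rightarrow> ((nat list \<Rightarrow> 'k::field) \<Rightarrow> 'l) \<times> ((nat list \<times> nat \<Rightarrow> 'k) \<Rightarrow> 'v)
    \<Rightarrow> 'k whom
    \<Rightarrow> ((nat list \<Rightarrow> 'k) \<Rightarrow> 'l) \<times> ((nat list \<times> nat \<Rightarrow> 'k) \<Rightarrow> 'v)" where
  "compG A g f = (restrict (fst g \<circ> fst f) (Lfree (fst A)), restrict (snd g \<circ> snd f) (AYfree (fst A) (snd A)))"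

lemma compG_gen:
  "p \<in> Lfree (fst A) \<Longrightarrow> fst (compG A g f) p = fst g (fst f p)"
  "m \<in> AYfree (fst A) (snd A) \<Longrightarrow> snd (compG A g f) m = snd g (snd f m)"
  by (auto simp: compG_def)

lemma compW_eq_compG: "compW = compG"
  by (auto simp: fun_eq_iff compW_def compG_def)

lemma comp_hom_gen:
  assumes f: "f \<in> homW A B" and g: "g \<in> hom_gen (fst B) (snd B) CL CV sL bL sV act"
  shows "compG A g f \<in> hom_gen (fst A) (snd A) CL CV sL bL sV act"
proof -
  note f' = f[unfolded homW_def]
  note [simp] = hom_fst_add[OF f'] hom_fst_br[OF f'] hom_fst_psc[OF f'] hom_snd_add[OF f']
    hom_snd_psc[OF f'] hom_snd_pact[OF f'] hom_fst_in[OF f'] hom_snd_in[OF f']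
    hom_fst_add[OF g] hom_fst_br[OF g] hom_fst_psc[OF g] hom_snd_add[OF g]
    hom_snd_psc[OF g] hom_snd_pact[OF g] hom_fst_in[OF g] hom_snd_in[OF g]
  show ?thesis
    unfolding compG_def hom_gen_def
    by (auto simp: Lfree.intros AYfree_add AYfree_psc AYfree_pact_Lfree)
qed

lemma compW_hom: "f \<in> homW A B \<Longrightarrow> g \<in> homW B C \<Longrightarrow> compW A g f \<in> homW A C"
  using comp_hom_gen unfolding compW_eq_compG homW_def[of B C] homW_def[of A C] .

lemma homWD:
  assumes "f \<in> homW A B"
  shows homW_fst_in: "p \<in> Lfree (fst A) \<Longrightarrow> fst f p \<in> Lfree (fst B)"
    and homW_snd_in: "m \<in> AYfree (fst A) (snd A) \<Longrightarrow> snd f m \<in> AYfree (fst B) (snd B)"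
    and homW_fst_add: "p \<in> Lfree (fst A) \<Longrightarrow> q \<in> Lfree (fst A) \<Longrightarrow> fst f (p + q) = fst f p + fst f q"
    and homW_fst_br: "p \<in> Lfree (fst A) \<Longrightarrow> q \<in> Lfree (fst A) \<Longrightarrow> fst f (pbr p q) = pbr (fst f p) (fst f q)"
    and homW_fst_psc: "p \<in> Lfree (fst A) \<Longrightarrow> fst f (psc c p) = psc c (fst f p)"
    and homW_snd_add: "m \<in> AYfree (fst A) (snd A) \<Longrightarrow> n \<in> AYfree (fst A) (snd A) \<Longrightarrow>
      snd f (m + n) = snd f m + snd f n"
    and homW_snd_psc: "m \<in> AYfree (fst A) (snd A) \<Longrightarrow> snd f (psc c m) = psc c (snd f m)"
    and homW_snd_pact: "p \<in> Lfree (fst A) \<Longrightarrow> m \<in> AYfree (fst A) (snd A) \<Longrightarrow>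
      snd f (pact p m) = pact (fst f p) (snd f m)"
    and homW_zero: "fst f 0 = 0" "snd f 0 = 0"
  using hom_genD[OF assms[unfolded homW_def]] hom_gen_zero[OF assms[unfolded homW_def]] by blast+

section \<open>Objects of rank at most one and their endomorphisms\<close>

lemma Lfree_empty: "p \<in> Lfree {} \<Longrightarrow> p = 0"
  by (induction rule: Lfree.induct) auto

text \<open>Brackets of multiples of one letter vanish, so L(x) is a line, with the coefficient of
  the word \<open>[x]\<close> as coordinate.\<close>

lemma Lfree_single: "p \<in> Lfree {x} \<Longrightarrow> p = psc (p [x]) (pgen x)"
proof -
  assume "p \<in> Lfree {x}"
  then have "\<exists>c. p = psc c (pgen x)"
  proof (induction rule: Lfree.induct)
    case zero
    then show ?case by (metis psc_simps(2))
  next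
    case (gen y)
    then show ?case by (metis psc_simps(3) singletonD)
  next
    case (add p q)
    then show ?case by (metis psc_add_left)
  next
    case (smul p c)
    then show ?case by (metis psc_simps(4))
  next
    case (br p q)
    then obtain c d where "p = psc c (pgen x)" "q = psc d (pgen x)" by blast
    then have "pbr p q = psc 0 (pgen x)" by simp
    then show ?case by blast
  qed
  then show ?thesis by (auto simp: psc_apply pgen_def)
qed

lemma AYfree_empty: "m \<in> AYfree X {} \<Longrightarrow> m = 0"
  by (auto simp: AYfree_def fun_eq_iff zero_fun_apply)

lemma AYfree_single: "m \<in> AYfree {} {y} \<Longrightarrow> m = psc (m ([], y)) (ygen y)"
  by (auto simp: AYfree_def fun_eq_iff psc_apply ygen_def mon_def)

lemma pact_pgen_ygen: "pact (pgen x) (ygen y) = mon ([x], y)"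
  by (simp add: pgen_eq_mon ygen_def pact_mon)

text \<open>With two generators a, b of one sort, the projection onto a fails to commute with the
  map sending a to b and all else to 0. With one generator of each sort, killing the letters while
  fixing the module generators fails to commute with letting a letter act on the module
  generators.\<close>

lemma commutative_End_cases:
  assumes comm: "\<And>f g :: 'k::field whom. f \<in> homW A A \<Longrightarrow> g \<in> homW A A \<Longrightarrow> compW A f g = compW A g f"
  obtains "A = ({}, {})" | x where "A = ({x}, {})" | y where "A = ({}, {y})"
proof -
  obtain X Y where A: "A = (X, Y)" by fastforce
  have 1: "a = b" if "a \<in> X" "b \<in> X" for a b
  proof (rule ccontr)
    assume "a \<noteq> b"
    define f :: "'k whom" where "f = sub A (\<lambda>i. if i = a then pgen a else 0) (\<lambda>_. 0)"
    define g :: "'k whom" where "g = sub A (\<lambda>i. if i = a then pgen b else 0) (\<lambda>_. 0)"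
    have fg: "f \<in> homW A A" "g \<in> homW A A"
      unfolding f_def g_def using that A by (auto intro!: sub_hom simp: Lfree.gen Lfree.zero)
    have "fst (compW A g f) (pgen a) = pgen b" "fst (compW A f g) (pgen a) = 0"
      using that A \<open>a \<noteq> b\<close> by (simp_all add: compW_gen Lfree.gen f_def g_def sub_gen)
    then show False using comm[OF fg] by simp
  qed
  have 2: "a = b" if "a \<in> Y" "b \<in> Y" for a b
  proof (rule ccontr)
    assume "a \<noteq> b"
    define f :: "'k whom" where "f = sub A (\<lambda>_. 0) (\<lambda>i. if i = a then ygen a else 0)"
    define g :: "'k whom" where "g = sub A (\<lambda>_. 0) (\<lambda>i. if i = a then ygen b else 0)"
    have fg: "f \<in> homW A A" "g \<in> homW A A"
      unfolding f_def g_def using that A by (auto intro!: sub_hom simp: Lfree.zero)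
    have "snd (compW A g f) (ygen a) = ygen b" "snd (compW A f g) (ygen a) = 0"
      using that A \<open>a \<noteq> b\<close> by (simp_all add: compW_gen f_def g_def sub_gen)
    then show False using comm[OF fg] by simp
  qed
  have 3: False if "a \<in> X" "y \<in> Y" for a y
  proof -
    define f :: "'k whom" where "f = sub A (\<lambda>_. 0) ygen"
    define g :: "'k whom" where "g = sub A pgen (\<lambda>z. pact (pgen a) (ygen z))"
    have fg: "f \<in> homW A A" "g \<in> homW A A"
      unfolding f_def g_def using that A
      by (auto intro!: sub_hom AYfree_pact_Lfree simp: Lfree.zero Lfree.gen)
    have "snd (compW A f g) (ygen y) = snd f (pact (pgen a) (ygen y))"
      using that A by (simp add: compW_gen g_def sub_gen)
    also have "\<dots> = 0"
      using that A homW_snd_pact[OF fg(1)] by (simp add: f_def sub_gen Lfree.gen)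
    finally have "snd (compW A f g) (ygen y) = 0" .
    moreover have "snd (compW A g f) (ygen y) = mon ([a], y)"
      using that A by (simp add: compW_gen f_def g_def sub_gen pact_pgen_ygen)
    ultimately show False using comm[OF fg] by simp
  qed
  have "X = {} \<or> (\<exists>a. X = {a})" "Y = {} \<or> (\<exists>b. Y = {b})" using 1 2 by blast+
  then show thesis using 3 A that by auto
qed

lemma homW_P_eqI:
  assumes "f \<in> homW ({x}, {}) A" "g \<in> homW ({x}, {}) A" "fst f (pgen x) = fst g (pgen x)"
  shows "f = g"
  using assms by (intro homW_eqI[of f "({x}, {})" A g]) auto

lemma homW_Q_eqI:
  assumes "f \<in> homW ({}, {y}) A" "g \<in> homW ({}, {y}) A" "snd f (ygen y) = snd g (ygen y)"
  shows "f = g"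
  using assms by (intro homW_eqI[of f "({}, {y})" A g]) auto

lemma homW_P_single:
  assumes "f \<in> homW ({x}, {}) ({x'}, {})"
  obtains c where "fst f (pgen x) = psc c (pgen x')"
  using Lfree_single homW_fst_in[OF assms, of "pgen x"] by (auto simp: Lfree.gen)

lemma homW_Q_single:
  assumes "f \<in> homW ({}, {y}) ({}, {y'})"
  obtains c where "snd f (ygen y) = psc c (ygen y')"
  using AYfree_single homW_snd_in[OF assms, of "ygen y"] by auto

lemma commutative_End_P:
  assumes "f \<in> homW ({x}, {}) ({x}, {})" "g \<in> homW ({x}, {}) ({x}, {})"
  shows "compW ({x}, {}) f g = compW ({x}, {}) g f"
proof -
  obtain c d where "fst f (pgen x) = psc c (pgen x)" "fst g (pgen x) = psc d (pgen x)"
    using assms homW_P_single by metis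
  then show ?thesis
    using assms
    by (intro homW_P_eqI[of _ x "({x}, {})"] compW_hom[of _ _ "({x}, {})"])
      (auto simp: compW_gen Lfree.gen homW_fst_psc[OF assms(1)] homW_fst_psc[OF assms(2)] mult.commute)
qed

lemma commutative_End_Q:
  assumes "f \<in> homW ({}, {y}) ({}, {y})" "g \<in> homW ({}, {y}) ({}, {y})"
  shows "compW ({}, {y}) f g = compW ({}, {y}) g f"
proof -
  obtain c d where "snd f (ygen y) = psc c (ygen y)" "snd g (ygen y) = psc d (ygen y)"
    using assms homW_Q_single by metis
  then show ?thesis
    using assms
    by (intro homW_Q_eqI[of _ y "({}, {y})"] compW_hom[of _ _ "({}, {y})"])
      (auto simp: compW_gen homW_snd_psc[OF assms(1)] homW_snd_psc[OF assms(2)] mult.commute)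
qed

lemma sub_P_hom: "l \<in> Lfree (fst A) \<Longrightarrow> sub ({x}, {}) (\<lambda>_. l) (\<lambda>_. 0) \<in> homW ({x}, {}) A"
  by (rule sub_hom) auto

lemma sub_Q_hom: "m \<in> AYfree (fst A) (snd A) \<Longrightarrow> sub ({}, {y}) (\<lambda>_. 0) (\<lambda>_. m) \<in> homW ({}, {y}) A"
  by (rule sub_hom) auto

lemma sub_P_gen [simp]: "fst (sub ({x}, {}) (\<lambda>_. l) v) (pgen x) = l"
  by (simp add: sub_gen)

lemma sub_Q_gen [simp]: "snd (sub ({}, {y}) a (\<lambda>_. m)) (ygen y) = m"
  by (simp add: sub_gen)

lemma sub_P_unique:
  assumes "f \<in> homW ({x}, {}) A"
  shows "f = sub ({x}, {}) (\<lambda>_. fst f (pgen x)) (\<lambda>_. 0)"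
  using assms homW_fst_in[OF assms, of "pgen x"]
  by (intro homW_P_eqI) (auto intro: sub_P_hom simp: Lfree.gen)

lemma sub_Q_unique:
  assumes "f \<in> homW ({}, {y}) A"
  shows "f = sub ({}, {y}) (\<lambda>_. 0) (\<lambda>_. snd f (ygen y))"
  using assms homW_snd_in[OF assms, of "ygen y"]
  by (intro homW_Q_eqI) (auto intro: sub_Q_hom)

section \<open>Closed pairs\<close>

text \<open>A pair always lies in its double prime. The converse inclusion is put contrapositively:
  some solution separates each outside element from the pair.\<close>

lemma closed_HI:
  assumes "T1 \<subseteq> Lfree (fst W)" "T2 \<subseteq> AYfree (fst W) (snd W)"
    and "\<And>l. l \<in> Lfree (fst W) \<Longrightarrow> l \<notin> T1 \<Longrightarrow> \<exists>h\<in>prime_H H W T1 T2. fst h l \<noteq> 0"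
    and "\<And>v. v \<in> AYfree (fst W) (snd W) \<Longrightarrow> v \<notin> T2 \<Longrightarrow> \<exists>h\<in>prime_H H W T1 T2. snd h v \<noteq> 0"
  shows "(T1, T2) \<in> closed_H H W"
proof -
  have "fst h l = 0" if "h \<in> prime_H H W T1 T2" "l \<in> T1" for h l
    using that by (auto simp: prime_H_def)
  moreover have "snd h l = 0" if "h \<in> prime_H H W T1 T2" "l \<in> T2" for h l
    using that by (auto simp: prime_H_def)
  ultimately show ?thesis using assms
    unfolding closed_H_def dprime_H_def case_prod_unfold by simp blast
qed

lemma closed_HD:
  assumes "T \<in> closed_H H W"
  shows "fst T \<subseteq> Lfree (fst W)" "snd T \<subseteq> AYfree (fst W) (snd W)"
    and "l \<in> Lfree (fst W) \<Longrightarrow> l \<notin> fst T \<Longrightarrow> \<exists>h\<in>prime_H H W (fst T) (snd T). fst h l \<noteq> 0"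
    and "v \<in> AYfree (fst W) (snd W) \<Longrightarrow> v \<notin> snd T \<Longrightarrow> \<exists>h\<in>prime_H H W (fst T) (snd T). snd h v \<noteq> 0"
  using assms unfolding closed_H_def dprime_H_def case_prod_unfold by (auto simp: prod_eq_iff)

lemma prime_HD:
  assumes "h \<in> prime_H H W T1 T2"
  shows "h \<in> homH H W" "l \<in> T1 \<Longrightarrow> fst h l = 0" "v \<in> T2 \<Longrightarrow> snd h v = 0"
  using assms by (auto simp: prime_H_def)

lemma prime_HI:
  assumes "h \<in> homH H W" "\<And>l. l \<in> T1 \<Longrightarrow> fst h l = 0" "\<And>v. v \<in> T2 \<Longrightarrow> snd h v = 0"
  shows "h \<in> prime_H H W T1 T2"
  using assms by (auto simp: prime_H_def)

lemma dprime_subset: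
  assumes "T1 \<subseteq> Lfree (fst W)" "T2 \<subseteq> AYfree (fst W) (snd W)"
  shows "T1 \<subseteq> fst (dprime_H H W T1 T2)" "T2 \<subseteq> snd (dprime_H H W T1 T2)"
  using assms by (auto simp: dprime_H_def prime_H_def)

lemma dprime_closed:
  assumes "T1 \<subseteq> Lfree (fst W)" "T2 \<subseteq> AYfree (fst W) (snd W)"
  shows "dprime_H H W T1 T2 \<in> closed_H H W"
proof -
  let ?D = "dprime_H H W T1 T2"
  \<comment> \<open>A pair and its double prime have the same solutions, so taking the double prime
    again changes nothing.\<close>
  have eq: "prime_H H W (fst ?D) (snd ?D) = prime_H H W T1 T2"
    using dprime_subset[OF assms, of H]
    by (auto simp: prime_H_def[of H W "fst ?D"] prime_H_def[of H W T1])
      (auto simp: dprime_H_def prime_H_def)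
  have "(fst ?D, snd ?D) \<in> closed_H H W"
    by (rule closed_HI, unfold eq) (auto simp: dprime_H_def, force+)
  then show ?thesis by simp
qed

text \<open>Enlarging a pair can only lose solutions, and fewer solutions have larger common
  kernels. Hence the double prime is the least closed pair above the given one.\<close>

lemma dprime_least:
  assumes "T \<in> closed_H H W" "T1 \<subseteq> fst T" "T2 \<subseteq> snd T"
  shows "fst (dprime_H H W T1 T2) \<subseteq> fst T" "snd (dprime_H H W T1 T2) \<subseteq> snd T"
proof -
  have sub: "h \<in> prime_H H W T1 T2" if "h \<in> prime_H H W (fst T) (snd T)" for h
    using that assms(2,3) by (auto simp: prime_H_def)
  show "fst (dprime_H H W T1 T2) \<subseteq> fst T"
  proof
    fix l assume "l \<in> fst (dprime_H H W T1 T2)"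
    then have "l \<in> Lfree (fst W)" "\<And>h. h \<in> prime_H H W T1 T2 \<Longrightarrow> fst h l = 0"
      by (auto simp: dprime_H_def)
    then show "l \<in> fst T" using closed_HD(3)[OF assms(1)] sub by blast
  qed
  show "snd (dprime_H H W T1 T2) \<subseteq> snd T"
  proof
    fix l assume "l \<in> snd (dprime_H H W T1 T2)"
    then have "l \<in> AYfree (fst W) (snd W)" "\<And>h. h \<in> prime_H H W T1 T2 \<Longrightarrow> snd h l = 0"
      by (auto simp: dprime_H_def)
    then show "l \<in> snd T" using closed_HD(4)[OF assms(1)] sub by blast
  qed
qed

text \<open>The double prime, being the least closed pair above a pair, is determined by the family
  of closed pairs; two representations with the same closed pairs therefore have the same closure
  operator.\<close>

lemma geom_equiv_iff_closed:
  fixes H1 :: "('k::field, 'l1::ab_group_add, 'v1::ab_group_add) rep"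
    and H2 :: "('k, 'l2::ab_group_add, 'v2::ab_group_add) rep"
  shows
  "geom_equiv H1 H2 \<longleftrightarrow> (\<forall>W\<in>Ob. closed_H H1 W = closed_H H2 W)"
proof
  assume "geom_equiv H1 H2"
  then show "\<forall>W\<in>Ob. closed_H H1 W = closed_H H2 W"
    by (fastforce simp: geom_equiv_def closed_H_def)
next
  assume eq: "\<forall>W\<in>Ob. closed_H H1 W = closed_H H2 W"
  show "geom_equiv H1 H2"
    unfolding geom_equiv_def
  proof (intro ballI allI impI)
    fix W and T1 :: "(nat list \<Rightarrow> 'k) set" and T2 :: "(nat list \<times> nat \<Rightarrow> 'k) set"
    assume W: "W \<in> Ob" and T: "T1 \<subseteq> Lfree (fst W)" "T2 \<subseteq> AYfree (fst W) (snd W)"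
    let ?D1 = "dprime_H H1 W T1 T2" and ?D2 = "dprime_H H2 W T1 T2"
    have "?D2 \<in> closed_H H1 W" "?D1 \<in> closed_H H2 W" using eq W dprime_closed[OF T, of H1] dprime_closed[OF T, of H2] by auto
    from dprime_least[OF this(1) dprime_subset[OF T]] dprime_least[OF this(2) dprime_subset[OF T]]
    show "?D1 = ?D2" by (auto simp: prod_eq_iff)
  qed
qed

lemma homH_compG: "f \<in> homW A B \<Longrightarrow> h \<in> homH H B \<Longrightarrow> compG A h f \<in> homH H A"
  unfolding homH_def case_prod_unfold by (rule comp_hom_gen)

text \<open>Composing with the inverse \<open>g\<close> turns solutions of \<open>T\<close> into
  solutions of its image; one that is nonzero at \<open>g l\<close> gives one that is nonzero at
  \<open>l\<close>.\<close>

lemma closed_H_image: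
  assumes h: "h \<in> homW A B" and g: "g \<in> homW B A"
    and gh: "\<And>l. l \<in> Lfree (fst A) \<Longrightarrow> fst g (fst h l) = l"
      "\<And>v. v \<in> AYfree (fst A) (snd A) \<Longrightarrow> snd g (snd h v) = v"
    and hg: "\<And>l. l \<in> Lfree (fst B) \<Longrightarrow> fst h (fst g l) = l"
      "\<And>v. v \<in> AYfree (fst B) (snd B) \<Longrightarrow> snd h (snd g v) = v"
    and T: "T \<in> closed_H H A"
  shows "(fst h ` fst T, snd h ` snd T) \<in> closed_H H B"
proof (rule closed_HI)
  note T12 = closed_HD(1,2)[OF T]
  show "fst h ` fst T \<subseteq> Lfree (fst B)" "snd h ` snd T \<subseteq> AYfree (fst B) (snd B)"
    using T12 homW_fst_in[OF h] homW_snd_in[OF h] by auto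
  have comp: "compG B f g \<in> prime_H H B (fst h ` fst T) (snd h ` snd T)"
    if "f \<in> prime_H H A (fst T) (snd T)" for f
    using that T12 homW_fst_in[OF h] homW_snd_in[OF h]
    by (intro prime_HI homH_compG[OF g]) (auto dest: prime_HD simp: compG_gen gh subset_iff)
  show "\<exists>f\<in>prime_H H B (fst h ` fst T) (snd h ` snd T). fst f l \<noteq> 0"
    if l: "l \<in> Lfree (fst B)" "l \<notin> fst h ` fst T" for l
  proof -
    have "fst g l \<notin> fst T" using l hg by (metis image_eqI)
    then obtain f where "f \<in> prime_H H A (fst T) (snd T)" "fst f (fst g l) \<noteq> 0"
      using closed_HD(3)[OF T] homW_fst_in[OF g] l by blast
    then show ?thesis using comp l by (intro bexI[of _ "compG B f g"]) (auto simp: compG_gen)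
  qed
  show "\<exists>f\<in>prime_H H B (fst h ` fst T) (snd h ` snd T). snd f v \<noteq> 0"
    if v: "v \<in> AYfree (fst B) (snd B)" "v \<notin> snd h ` snd T" for v
  proof -
    have "snd g v \<notin> snd T" using v hg by (metis image_eqI)
    then obtain f where "f \<in> prime_H H A (fst T) (snd T)" "snd f (snd g v) \<noteq> 0"
      using closed_HD(4)[OF T] homW_snd_in[OF g] v by blast
    then show ?thesis using comp v by (intro bexI[of _ "compG B f g"]) (auto simp: compG_gen)
  qed
qed

text \<open>Closed pairs are intersections of kernels. Stability under scalars rests on
  \<open>sL c 0 = 0\<close> and \<open>sV c 0 = 0\<close>, which come from \<open>is_rep H\<close>.
  These properties let a single difference decide \<open>beta\<close> on a source of rank
  one.\<close>

lemma closed_H_subspace: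
  fixes H :: "('k::field, 'l::ab_group_add, 'v::ab_group_add) rep"
  assumes H: "is_rep H" and T: "T \<in> closed_H H W"
  shows "0 \<in> fst T" "0 \<in> snd T" "l \<in> fst T \<Longrightarrow> psc c l \<in> fst T" "v \<in> snd T \<Longrightarrow> psc c v \<in> snd T"
proof -
  obtain sL bL sV act where Heq: "H = (sL, bL, sV, act)" by (metis prod_cases4)
  have sc: "sL c 0 = 0" "sV c 0 = 0" for c
    using H module.scale_zero_right[of sL] module.scale_zero_right[of sV]
    by (auto simp: Heq is_rep_def lie_algebra_def module_iff_vector_space)
  have hom: "h \<in> hom_gen (fst W) (snd W) UNIV UNIV sL bL sV act" if "h \<in> prime_H H W (fst T) (snd T)" for h
    using prime_HD(1)[OF that] by (simp add: homH_def Heq)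
  note T12 = closed_HD[OF T]
  show "0 \<in> fst T" using T12(3)[of 0] hom_gen_zero(1)[OF hom] Lfree.zero by blast
  show "0 \<in> snd T" using T12(4)[of 0] hom_gen_zero(2)[OF hom] AYfree_zero by blast
  show "psc c l \<in> fst T" if l: "l \<in> fst T"
  proof (rule ccontr)
    assume "psc c l \<notin> fst T"
    then obtain h where h: "h \<in> prime_H H W (fst T) (snd T)" "fst h (psc c l) \<noteq> 0"
      using T12 l Lfree.smul by blast
    then show False using hom_fst_psc[OF hom[OF h(1)]] prime_HD(2)[OF h(1) l] l T12(1) sc by auto
  qed
  show "psc c v \<in> snd T" if v: "v \<in> snd T"
  proof (rule ccontr)
    assume "psc c v \<notin> snd T"
    then obtain h where h: "h \<in> prime_H H W (fst T) (snd T)" "snd h (psc c v) \<noteq> 0"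
      using T12 v AYfree_psc by blast
    then show False using hom_snd_psc[OF hom[OF h(1)]] prime_HD(3)[OF h(1) v] v T12(2) sc by auto
  qed
qed

lemma homW_inverse:
  assumes h: "h \<in> homW A B"
    and b1: "bij_betw (fst h) (Lfree (fst A)) (Lfree (fst B))"
    and b2: "bij_betw (snd h) (AYfree (fst A) (snd A)) (AYfree (fst B) (snd B))"
  obtains g where "g \<in> homW B A"
    "\<And>l. l \<in> Lfree (fst A) \<Longrightarrow> fst g (fst h l) = l" "\<And>v. v \<in> AYfree (fst A) (snd A) \<Longrightarrow> snd g (snd h v) = v"
    "\<And>l. l \<in> Lfree (fst B) \<Longrightarrow> fst h (fst g l) = l" "\<And>v. v \<in> AYfree (fst B) (snd B) \<Longrightarrow> snd h (snd g v) = v"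
proof -
  define g1 where "g1 = restrict (inv_into (Lfree (fst A)) (fst h)) (Lfree (fst B))"
  define g2 where "g2 = restrict (inv_into (AYfree (fst A) (snd A)) (snd h)) (AYfree (fst B) (snd B))"
  have in1: "g1 l \<in> Lfree (fst A)" and hg1: "fst h (g1 l) = l" if "l \<in> Lfree (fst B)" for l
    using that b1 by (auto simp: g1_def bij_betw_def f_inv_into_f inv_into_into)
  have in2: "g2 l \<in> AYfree (fst A) (snd A)" and hg2: "snd h (g2 l) = l" if "l \<in> AYfree (fst B) (snd B)" for l
    using that b2 by (auto simp: g2_def bij_betw_def f_inv_into_f inv_into_into)
  have gh1: "g1 (fst h l) = l" if "l \<in> Lfree (fst A)" for l
    using that b1 homW_fst_in[OF h that] by (auto simp: g1_def bij_betw_def)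
  have gh2: "g2 (snd h l) = l" if "l \<in> AYfree (fst A) (snd A)" for l
    using that b2 homW_snd_in[OF h that] by (auto simp: g2_def bij_betw_def)
  \<comment> \<open>These rules move every law of the inverse to the other side: to compute
    \<open>g1\<close> at an element it suffices to exhibit a preimage under
    \<open>fst h\<close>.\<close>
  have e1: "g1 l = l'" if "l' \<in> Lfree (fst A)" "fst h l' = l" for l l' using gh1 that by blast
  have e2: "g2 l = l'" if "l' \<in> AYfree (fst A) (snd A)" "snd h l' = l" for l l' using gh2 that by blast
  have "(g1, g2) \<in> homW B A"
    unfolding homW_def hom_gen_def
    by (auto simp: in1 in2 hg1 hg2 homW_fst_add[OF h] homW_fst_br[OF h] homW_fst_psc[OF h]
        homW_snd_add[OF h] homW_snd_psc[OF h] homW_snd_pact[OF h]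
        intro!: e1 e2 Lfree.intros AYfree_add AYfree_psc AYfree_pact_Lfree)
      (auto simp: g1_def g2_def)
  then show thesis using that[of "(g1, g2)"] gh1 gh2 hg1 hg2 by simp
qed

section \<open>Scaling the generators\<close>

lemma wprod_scale: "wprod (\<lambda>i. psc (c i) (pgen i)) w = psc (prod_list (map c w)) (mon w)"
  by (induction w) (simp_all add: pgen_eq_mon pmul_mon mult.commute)

lemma subst_A_scale:
  assumes "p \<in> Afree X"
  shows "subst_A (\<lambda>i. psc (c i) (pgen i)) p w = prod_list (map c w) * p w"
  using assms
proof (induction rule: Afree_induct)
  case (mon d u)
  have "finite {z. mon u z \<noteq> (0::'a)}" by (simp add: mon_def)
  then have "subst_A (\<lambda>i. psc (c i) (pgen i)) (psc d (mon u)) = psc (d * prod_list (map c u)) (mon u)"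
    by (simp add: subst_A_def lext_psc wprod_scale)
  then have "subst_A (\<lambda>i. psc (c i) (pgen i)) (psc d (mon u)) w = prod_list (map c w) * psc d (mon u) w"
    by (auto simp: psc_apply mon_def)
  then show ?case .
next
  case (add q r)
  then have "subst_A (\<lambda>i. psc (c i) (pgen i)) (q + r) = subst_A (\<lambda>i. psc (c i) (pgen i)) q + subst_A (\<lambda>i. psc (c i) (pgen i)) r"
    by (simp add: subst_A_def lext_add Afree_finite[of _ X])
  then have "subst_A (\<lambda>i. psc (c i) (pgen i)) (q + r) w = prod_list (map c w) * (q + r) w"
    using add by (simp add: plus_fun_apply algebra_simps)
  then show ?case .
next
  case zero
  have "subst_A (\<lambda>i. psc (c i) (pgen i)) 0 w = prod_list (map c w) * 0 w"
    by (simp add: subst_A_def zero_fun_apply)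
  then show ?case .
qed

lemma subst_M_scale:
  assumes "m \<in> AYfree X Y"
  shows "subst_M (\<lambda>i. psc (c i) (pgen i)) ygen m (w, y) = prod_list (map c w) * m (w, y)"
  using assms
proof (induction rule: AYfree_induct)
  case (mon d u z)
  have "finite {x. mon (u, z) x \<noteq> (0::'a)}" by (simp add: mon_def)
  then have "subst_M (\<lambda>i. psc (c i) (pgen i)) ygen (psc d (mon (u, z)))
      = psc (d * prod_list (map c u)) (mon (u, z))"
    by (simp add: subst_M_def lext_psc wprod_scale ygen_def pact_mon)
  then have "subst_M (\<lambda>i. psc (c i) (pgen i)) ygen (psc d (mon (u, z))) (w, y)
      = prod_list (map c w) * psc d (mon (u, z)) (w, y)"
    by (auto simp: psc_apply mon_def)
  then show ?case .
next
  case (add q r)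
  then have "subst_M (\<lambda>i. psc (c i) (pgen i)) ygen (q + r)
      = subst_M (\<lambda>i. psc (c i) (pgen i)) ygen q + subst_M (\<lambda>i. psc (c i) (pgen i)) ygen r"
    by (simp add: subst_M_def lext_add AYfree_finite[of _ X Y])
  then have "subst_M (\<lambda>i. psc (c i) (pgen i)) ygen (q + r) (w, y) = prod_list (map c w) * (q + r) (w, y)"
    using add by (simp add: plus_fun_apply algebra_simps)
  then show ?case .
next
  case zero
  have "subst_M (\<lambda>i. psc (c i) (pgen i)) ygen 0 (w, y) = prod_list (map c w) * 0 (w, y)"
    by (simp add: subst_M_def zero_fun_apply)
  then show ?case .
qed

text \<open>Diagonal on monomials: a word is multiplied by the product of \<open>c\<close> over its
  letters, and the module generators stay fixed. Comparing coefficients after applying it reveals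
  the multidegree of an element.\<close>

definition scale :: "obj \<Rightarrow> (nat \<Rightarrow> 'k::field) \<Rightarrow> 'k whom" where
  "scale A c = sub A (\<lambda>i. psc (c i) (pgen i)) ygen"

lemma scale_hom: "scale A c \<in> homW A A"
  unfolding scale_def by (rule sub_hom) (auto intro: Lfree.smul Lfree.gen)

lemma scale_apply:
  "p \<in> Lfree (fst A) \<Longrightarrow> fst (scale A c) p w = prod_list (map c w) * p w"
  "m \<in> AYfree (fst A) (snd A) \<Longrightarrow> snd (scale A c) m (w, y) = prod_list (map c w) * m (w, y)"
  by (simp_all add: scale_def sub_def subst_A_scale[OF Lfree_subset_Afree] subst_M_scale)

lemma scale_gen:
  "x \<in> fst A \<Longrightarrow> fst (scale A c) (pgen x) = psc (c x) (pgen x)"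
  "y \<in> snd A \<Longrightarrow> snd (scale A c) (ygen y) = ygen y"
  by (simp_all add: scale_def sub_gen)

text \<open>Characteristic 0 lets the equation be read in the naturals. The scalar 2 thereby
  separates degree one from all other degrees.\<close>

lemma two_power_eq_two: "(2 :: 'k::field_char_0) ^ n = 2 \<Longrightarrow> n = 1"
proof -
  assume "(2 :: 'k) ^ n = 2"
  then have "of_nat (2 ^ n) = (of_nat 2 :: 'k)" by simp
  then have "(2::nat) ^ n = 2 ^ 1" unfolding of_nat_eq_iff by simp
  then show "n = 1" by (subst (asm) power_inject_exp) auto
qed

lemma prod_list_indicator: "prod_list (map (\<lambda>i. if i = a then c else 1) w) = c ^ count_list w a"
  by (induction w) auto

lemma count_two_letters: "set w \<subseteq> {a, b} \<Longrightarrow> a \<noteq> b \<Longrightarrow> length w = count_list w a + count_list w b"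
  by (induction w) auto

section \<open>Automorphisms of the category\<close>

locale category_auto =
  fixes Fo :: "obj \<Rightarrow> obj" and Fm :: "obj \<Rightarrow> obj \<Rightarrow> 'k::field_char_0 whom \<Rightarrow> 'k whom"
  assumes cat_auto: "cat_auto Fo Fm"
begin

lemma Fo_surj: "B \<in> Ob \<Longrightarrow> \<exists>A\<in>Ob. Fo A = B"
  using cat_auto unfolding cat_auto_def bij_betw_def by (metis imageE)

lemma Fm_bij: "A \<in> Ob \<Longrightarrow> B \<in> Ob \<Longrightarrow> bij_betw (Fm A B) (homW A B) (homW (Fo A) (Fo B))"
  using cat_auto by (auto simp: cat_auto_def)

lemma Fm_hom: "A \<in> Ob \<Longrightarrow> B \<in> Ob \<Longrightarrow> f \<in> homW A B \<Longrightarrow> Fm A B f \<in> homW (Fo A) (Fo B)"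
  using Fm_bij[of A B] by (auto simp: bij_betw_def)

lemma Fm_surj: "A \<in> Ob \<Longrightarrow> B \<in> Ob \<Longrightarrow> g \<in> homW (Fo A) (Fo B) \<Longrightarrow> \<exists>f\<in>homW A B. Fm A B f = g"
  using Fm_bij[of A B] unfolding bij_betw_def by (metis imageE)

lemma Fm_inj: "A \<in> Ob \<Longrightarrow> B \<in> Ob \<Longrightarrow> f \<in> homW A B \<Longrightarrow> g \<in> homW A B \<Longrightarrow> Fm A B f = Fm A B g \<Longrightarrow> f = g"
  using Fm_bij[of A B] by (auto simp: bij_betw_def inj_on_def)

lemma Fm_comp:
  "A \<in> Ob \<Longrightarrow> B \<in> Ob \<Longrightarrow> C \<in> Ob \<Longrightarrow> f \<in> homW A B \<Longrightarrow> g \<in> homW B C \<Longrightarrow>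
    Fm A C (compW A g f) = compW (Fo A) (Fm B C g) (Fm A B f)"
  using cat_auto by (auto simp: cat_auto_def)

abbreviation "P0 \<equiv> ({0}, {}) :: obj"
abbreviation "Q0 \<equiv> ({}, {0}) :: obj"
abbreviation "R0 \<equiv> ({0}, {0}) :: obj"

lemma Ob_simps [simp]: "P0 \<in> Ob" "Q0 \<in> Ob" "R0 \<in> Ob"
  by (auto simp: Ob_def)

lemma commutative_End_transfer:
  assumes A: "A \<in> Ob"
    and comm: "\<And>f g :: 'k whom. f \<in> homW A A \<Longrightarrow> g \<in> homW A A \<Longrightarrow> compW A f g = compW A g f"
    and f: "(f :: 'k whom) \<in> homW (Fo A) (Fo A)" and g: "g \<in> homW (Fo A) (Fo A)"
  shows "compW (Fo A) f g = compW (Fo A) g f"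
proof -
  obtain f' g' where "f' \<in> homW A A" "g' \<in> homW A A" "f = Fm A A f'" "g = Fm A A g'"
    using Fm_surj[OF A A f] Fm_surj[OF A A g] by metis
  then show ?thesis using Fm_comp[OF A A A] comm by metis
qed

lemma nontrivial_hom_transfer:
  assumes "A \<in> Ob" "B \<in> Ob" "(f :: 'k whom) \<in> homW A B" "g \<in> homW A B" "f \<noteq> g"
  obtains f' g' :: "'k whom" where "f' \<in> homW (Fo A) (Fo B)" "g' \<in> homW (Fo A) (Fo B)" "f' \<noteq> g'"
  using Fm_hom[OF assms(1,2)] Fm_inj[OF assms(1,2)] assms by metis

lemma trivial_hom_transfer:
  assumes "A \<in> Ob" "B \<in> Ob" "\<And>f g :: 'k whom. f \<in> homW A B \<Longrightarrow> g \<in> homW A B \<Longrightarrow> f = g"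
    and "(f' :: 'k whom) \<in> homW (Fo A) (Fo B)" "g' \<in> homW (Fo A) (Fo B)"
  shows "f' = g'"
  using Fm_surj[OF assms(1,2)] assms(3-5) by metis

text \<open>Both rank-one objects have a commutative endomorphism monoid. They are told apart by R0: its
  Lie part is the line spanned by x, so any two morphisms from P0 factor through each other, while
  the morphisms from Q0 with values y and xy do not.\<close>

lemma Fo_rank_one: "\<exists>x y. Fo P0 = ({x}, {}) \<and> Fo Q0 = ({}, {y})"
proof -
  have PP: "\<exists>f\<in>homW (Fo P0) (Fo P0). \<exists>g\<in>homW (Fo P0) (Fo P0). (f :: 'k whom) \<noteq> g"
  proof -
    have "fst (sub P0 (\<lambda>_. pgen 0) (\<lambda>_. 0)) (pgen 0) \<noteq> fst (sub P0 (\<lambda>_. 0 :: _ \<Rightarrow> 'k) (\<lambda>_. 0)) (pgen 0)"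
      by simp
    then have "sub P0 (\<lambda>_. pgen 0) (\<lambda>_. 0) \<noteq> sub P0 (\<lambda>_. 0 :: _ \<Rightarrow> 'k) (\<lambda>_. 0)" by metis
    then show ?thesis
      using nontrivial_hom_transfer[of P0 P0, OF _ _ sub_P_hom sub_P_hom] 
      by (metis Lfree.gen Lfree.zero Ob_simps(1) fst_conv singletonI)
  qed
  have PR: "\<exists>f\<in>homW (Fo P0) (Fo R0). \<exists>g\<in>homW (Fo P0) (Fo R0). (f :: 'k whom) \<noteq> g"
  proof -
    have "fst (sub P0 (\<lambda>_. pgen 0) (\<lambda>_. 0)) (pgen 0) \<noteq> fst (sub P0 (\<lambda>_. 0 :: _ \<Rightarrow> 'k) (\<lambda>_. 0)) (pgen 0)"
      by simp
    then have "sub P0 (\<lambda>_. pgen 0) (\<lambda>_. 0) \<noteq> sub P0 (\<lambda>_. 0 :: _ \<Rightarrow> 'k) (\<lambda>_. 0)" by metis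
    then show ?thesis
      using nontrivial_hom_transfer[of P0 R0, OF _ _ sub_P_hom sub_P_hom] 
      by (metis Lfree.gen Lfree.zero Ob_simps(1,3) fst_conv singletonI)
  qed
  have Qne: "sub Q0 (\<lambda>_. 0) (\<lambda>_. ygen 0) \<noteq> sub Q0 (\<lambda>_. 0) (\<lambda>_. 0 :: _ \<Rightarrow> 'k)"
    by (metis mon_nonzero(3) sub_Q_gen)
  have QQ: "\<exists>f\<in>homW (Fo Q0) (Fo Q0). \<exists>g\<in>homW (Fo Q0) (Fo Q0). (f :: 'k whom) \<noteq> g"
    using nontrivial_hom_transfer[of Q0 Q0, OF _ _ sub_Q_hom sub_Q_hom Qne]
    by (metis AYfree_ygen AYfree_zero Ob_simps(2) snd_conv singletonI)
  have QR: "\<exists>f\<in>homW (Fo Q0) (Fo R0). \<exists>g\<in>homW (Fo Q0) (Fo R0). (f :: 'k whom) \<noteq> g"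
    using nontrivial_hom_transfer[of Q0 R0, OF _ _ sub_Q_hom sub_Q_hom Qne]
    by (metis AYfree_ygen AYfree_zero Ob_simps(2,3) snd_conv singletonI)
  \<comment> \<open>Used to exclude that both rank-one objects go to objects of the same kind,
    between which there are nonzero morphisms.\<close>
  have PQ: "f = g" if "f \<in> homW (Fo P0) (Fo Q0)" "g \<in> homW (Fo P0) (Fo Q0)" for f g :: "'k whom"
  proof (rule trivial_hom_transfer[OF _ _ _ that])
    show "f = g" if "f \<in> homW P0 Q0" "g \<in> homW P0 Q0" for f g :: "'k whom"
      using homW_fst_in[OF that(1), of "pgen 0"] homW_fst_in[OF that(2), of "pgen 0"]
      by (intro homW_P_eqI[OF that]) (auto simp: Lfree.gen dest!: Lfree_empty)
  qed auto
  have chain: "\<exists>e\<in>homW (Fo P0) (Fo P0). f = compW (Fo P0) g e \<or> g = compW (Fo P0) f e"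
    if f: "f \<in> homW (Fo P0) (Fo R0)" and g: "g \<in> homW (Fo P0) (Fo R0)" for f g :: "'k whom"
  proof -
    have *: "\<exists>e\<in>homW P0 P0. f = compW P0 g e"
      if f: "f \<in> homW P0 R0" and g: "g \<in> homW P0 R0" and "fst f (pgen 0) = psc c (pgen 0)"
        "fst g (pgen 0) = psc d (pgen 0)" "d \<noteq> 0" for f g :: "'k whom" and c d
    proof -
      \<comment> \<open>Precomposition with an endomorphism of \<open>P0\<close> rescales the value
        at the generator, so the quotient of the coordinates is the required factor.\<close>
      let ?e = "sub P0 (\<lambda>_. psc (c / d) (pgen 0)) (\<lambda>_. 0)"
      have e: "?e \<in> homW P0 P0" by (rule sub_P_hom) (simp add: Lfree.gen Lfree.smul)
      have "f = compW P0 g ?e"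
        using that homW_fst_psc[OF g, of "pgen 0"]
        by (intro homW_P_eqI[OF f compW_hom[OF e g]]) (simp add: compW_gen Lfree.gen)
      then show ?thesis using e by blast
    qed
    obtain f' g' where f': "f' \<in> homW P0 R0" "f = Fm P0 R0 f'" and g': "g' \<in> homW P0 R0" "g = Fm P0 R0 g'"
      using Fm_surj[OF Ob_simps(1,3) f] Fm_surj[OF Ob_simps(1,3) g] by metis
    have "fst f' (pgen 0) \<in> Lfree {0}" "fst g' (pgen 0) \<in> Lfree {0}"
      using homW_fst_in[OF f'(1)] homW_fst_in[OF g'(1)] by (auto simp: Lfree.gen)
    then obtain c d where cd: "fst f' (pgen 0) = psc c (pgen 0)" "fst g' (pgen 0) = psc d (pgen 0)"
      using Lfree_single by metis
    have "\<exists>e\<in>homW P0 P0. f' = compW P0 g' e \<or> g' = compW P0 f' e"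
    proof (cases "d = 0 \<and> c = 0")
      case True
      then have "f' = g'" using cd by (intro homW_P_eqI[OF f'(1) g'(1)]) simp
      then have "f' = compW P0 g' (sub P0 (\<lambda>_. pgen 0) (\<lambda>_. 0))"
        using True cd homW_fst_in[OF g'(1)]
        by (intro homW_P_eqI[OF f'(1) compW_hom[OF sub_P_hom g'(1)]]) (auto simp: compW_gen Lfree.gen)
      then show ?thesis using sub_P_hom[of "pgen 0" P0 0] by (auto simp: Lfree.gen)
    next
      case False
      then show ?thesis using *[OF f'(1) g'(1) cd] *[OF g'(1) f'(1) cd(2,1)] by blast
    qed
    then show ?thesis using Fm_comp[of P0 P0 R0] f' g' Fm_hom[of P0 P0] by (metis Ob_simps(1,3))
  qed
  have P: "Fo P0 = ({}, {}) \<or> (\<exists>x. Fo P0 = ({x}, {})) \<or> (\<exists>y. Fo P0 = ({}, {y}))"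
    by (rule commutative_End_cases[of "Fo P0", OF commutative_End_transfer[OF Ob_simps(1) commutative_End_P]]) auto
  have Q: "Fo Q0 = ({}, {}) \<or> (\<exists>x. Fo Q0 = ({x}, {})) \<or> (\<exists>y. Fo Q0 = ({}, {y}))"
    by (rule commutative_End_cases[of "Fo Q0", OF commutative_End_transfer[OF Ob_simps(2) commutative_End_Q]]) auto
  have empty: "f = g" if "f \<in> homW ({}, {}) B" "g \<in> homW ({}, {}) B" for f g :: "'k whom" and B
    using homW_eqI[OF that] by simp
  \<comment> \<open>The empty object has only one endomorphism, whereas \<open>P0\<close> has at
    least two, and the automorphism preserves this.\<close>
  have P': "Fo P0 \<noteq> ({}, {})" using PP empty by metis
  have Q': "Fo Q0 \<noteq> ({}, {})" using QQ empty by metis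
  show ?thesis
  proof (cases "\<exists>x. Fo P0 = ({x}, {})")
    case True
    then obtain x where x: "Fo P0 = ({x}, {})" ..
    have "Fo Q0 \<noteq> ({z}, {})" for z
    proof
      assume z: "Fo Q0 = ({z}, {})"
      have "sub ({x}, {}) (\<lambda>_. pgen z) (\<lambda>_. 0) = sub ({x}, {}) (\<lambda>_. 0) (\<lambda>_. 0 :: _ \<Rightarrow> 'k)"
        by (rule PQ; unfold x z; rule sub_P_hom) (auto intro: Lfree.gen Lfree.zero)
      then show False by (metis mon_nonzero(2) sub_P_gen)
    qed
    then show ?thesis using x Q Q' by blast
  next
    case False
    then obtain y where y: "Fo P0 = ({}, {y})" using P P' by blast
    have "Fo Q0 \<noteq> ({}, {z})" for z
    proof
      assume z: "Fo Q0 = ({}, {z})"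
      have "sub ({}, {y}) (\<lambda>_. 0) (\<lambda>_. ygen z) = sub ({}, {y}) (\<lambda>_. 0) (\<lambda>_. 0 :: _ \<Rightarrow> 'k)"
        by (rule PQ; unfold y z; rule sub_Q_hom) auto
      then show False by (metis mon_nonzero(3) sub_Q_gen)
    qed
    then obtain x where x: "Fo Q0 = ({x}, {})" using Q Q' by blast
    \<comment> \<open>Only an exchange of the two kinds remains to be refuted. Distinct morphisms
      from \<open>Q0\<close> and from \<open>P0\<close> to \<open>R0\<close> force the image of
      \<open>R0\<close> to contain a letter and a module generator.\<close>
    obtain X Y where R: "Fo R0 = (X, Y)" by fastforce
    have "X \<noteq> {}"
    proof
      assume "X = {}"
      then have "f = g" if "f \<in> homW (Fo Q0) (Fo R0)" "g \<in> homW (Fo Q0) (Fo R0)" for f g :: "'k whom"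
        using that homW_fst_in[OF that(1), of "pgen x"] homW_fst_in[OF that(2), of "pgen x"]
        unfolding x R by (intro homW_P_eqI[of f x _ g]) (auto simp: Lfree.gen dest!: Lfree_empty)
      then show False using QR by blast
    qed
    moreover have "Y \<noteq> {}"
    proof
      assume "Y = {}"
      then have "f = g" if "f \<in> homW (Fo P0) (Fo R0)" "g \<in> homW (Fo P0) (Fo R0)" for f g :: "'k whom"
        using that homW_snd_in[OF that(1), of "ygen y"] homW_snd_in[OF that(2), of "ygen y"]
        unfolding y R by (intro homW_Q_eqI[of f y _ g]) (auto dest!: AYfree_empty)
      then show False using PR by blast
    qed
    ultimately obtain a b where ab: "a \<in> X" "b \<in> Y" by blast
    let ?f = "sub ({}, {y}) (\<lambda>_. 0) (\<lambda>_. ygen b) :: 'k whom"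
    let ?g = "sub ({}, {y}) (\<lambda>_. 0) (\<lambda>_. mon ([a], b)) :: 'k whom"
    have fg: "?f \<in> homW (Fo P0) (Fo R0)" "?g \<in> homW (Fo P0) (Fo R0)"
      unfolding y R using ab by (auto intro!: sub_Q_hom)
    obtain e where e: "e \<in> homW ({}, {y}) ({}, {y})"
      and or: "?f = compW ({}, {y}) ?g e \<or> ?g = compW ({}, {y}) ?f e"
      using chain[OF fg] unfolding y by blast
    obtain c where c: "snd e (ygen y) = psc c (ygen y)" using homW_Q_single[OF e] .
    \<comment> \<open>By \<open>chain\<close>, one of two distinct basis elements of the module
      would be a scalar multiple of the other.\<close>
    have "ygen b = psc c (mon ([a], b)) \<or> mon ([a], b) = psc c (ygen b :: _ \<Rightarrow> 'k)"
      using or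
    proof
      assume "?f = compW ({}, {y}) ?g e"
      then have "snd ?f (ygen y) = snd (compW ({}, {y}) ?g e) (ygen y)" by simp
      then show ?thesis using homW_snd_psc[OF fg(2), of "ygen y" c] c by (simp add: compW_gen y)
    next
      assume "?g = compW ({}, {y}) ?f e"
      then have "snd ?g (ygen y) = snd (compW ({}, {y}) ?f e) (ygen y)" by simp
      then show ?thesis using homW_snd_psc[OF fg(1), of "ygen y" c] c by (simp add: compW_gen y)
    qed
    then have False
    proof
      assume "ygen b = psc c (mon ([a], b))"
      from fun_cong[OF this, of "([], b)"] show False by (simp add: ygen_def psc_apply mon_def)
    next
      assume "mon ([a], b) = psc c (ygen b)"
      from fun_cong[OF this, of "([a], b)"] show False by (simp add: ygen_def psc_apply mon_def)
    qed
    then show ?thesis ..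
  qed
qed

end

lemma bij_betw_psc:
  assumes "c \<noteq> 0"
  shows "bij_betw (psc c) (Lfree X) (Lfree X)"
  by (rule bij_betw_byWitness[where f' = "psc (1 / c)"]) (use assms in \<open>auto intro: Lfree.smul\<close>)

lemma psc_gen_inject [simp]: "psc c (pgen x) = psc d (pgen x) \<longleftrightarrow> c = d"
  "psc c (ygen y) = psc d (ygen y) \<longleftrightarrow> c = d"
  by (auto simp: fun_eq_iff psc_apply pgen_def ygen_def mon_def)

lemma psc_gen_eq_self: "psc c (pgen x) = pgen x \<longleftrightarrow> c = 1" "psc c (ygen y) = ygen y \<longleftrightarrow> c = 1"
  using psc_gen_inject(1)[of c x 1] psc_gen_inject(2)[of c y 1] by simp_all

text \<open>A concrete Yoneda lemma: evaluation at the generator identifies morphisms from a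
  rank-one object with elements of L(X). Both directions are stated, for an arbitrary letter,
  because elements enter through \<open>P0\<close> and leave through its image.\<close>

lemma bij_betw_P:
  "bij_betw (\<lambda>l. sub ({x}, {}) (\<lambda>_. l) (\<lambda>_. 0)) (Lfree (fst A)) (homW ({x}, {}) A)"
  "bij_betw (\<lambda>f. fst f (pgen x)) (homW ({x}, {}) A) (Lfree (fst A))"
proof -
  have in_L: "fst f (pgen x) \<in> Lfree (fst A)" if "f \<in> homW ({x}, {}) A" for f
    using homW_fst_in[OF that] by (simp add: Lfree.gen)
  show "bij_betw (\<lambda>l. sub ({x}, {}) (\<lambda>_. l) (\<lambda>_. 0)) (Lfree (fst A)) (homW ({x}, {}) A)"
    by (rule bij_betw_byWitness[where f' = "\<lambda>f. fst f (pgen x)"])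
      (simp_all add: sub_P_unique[symmetric] in_L sub_P_hom image_subset_iff)
  show "bij_betw (\<lambda>f. fst f (pgen x)) (homW ({x}, {}) A) (Lfree (fst A))"
    by (rule bij_betw_byWitness[where f' = "\<lambda>l. sub ({x}, {}) (\<lambda>_. l) (\<lambda>_. 0)"])
      (simp_all add: sub_P_unique[symmetric] in_L sub_P_hom image_subset_iff)
qed

lemma bij_betw_Q:
  "bij_betw (\<lambda>m. sub ({}, {y}) (\<lambda>_. 0) (\<lambda>_. m)) (AYfree (fst A) (snd A)) (homW ({}, {y}) A)"
  "bij_betw (\<lambda>f. snd f (ygen y)) (homW ({}, {y}) A) (AYfree (fst A) (snd A))"
proof -
  have in_M: "snd f (ygen y) \<in> AYfree (fst A) (snd A)" if "f \<in> homW ({}, {y}) A" for f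
    using homW_snd_in[OF that] by simp
  show "bij_betw (\<lambda>m. sub ({}, {y}) (\<lambda>_. 0) (\<lambda>_. m)) (AYfree (fst A) (snd A)) (homW ({}, {y}) A)"
    by (rule bij_betw_byWitness[where f' = "\<lambda>f. snd f (ygen y)"])
      (simp_all add: sub_Q_unique[symmetric] in_M sub_Q_hom image_subset_iff)
  show "bij_betw (\<lambda>f. snd f (ygen y)) (homW ({}, {y}) A) (AYfree (fst A) (snd A))"
    by (rule bij_betw_byWitness[where f' = "\<lambda>m. sub ({}, {y}) (\<lambda>_. 0) (\<lambda>_. m)"])
      (simp_all add: sub_Q_unique[symmetric] in_M sub_Q_hom image_subset_iff)
qed

section \<open>The action of the automorphism on elements\<close>

locale pointed_category_auto = category_auto Fo Fm
  for Fo :: "obj \<Rightarrow> obj" and Fm :: "obj \<Rightarrow> obj \<Rightarrow> 'k::field_char_0 whom \<Rightarrow> 'k whom" +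
  fixes px qy :: nat
  assumes Fo_P0: "Fo P0 = ({px}, {})" and Fo_Q0: "Fo Q0 = ({}, {qy})"
    and rigid: "\<And>\<sigma> :: 'k \<Rightarrow> 'k. field_aut \<sigma> \<Longrightarrow> \<sigma> = id"
begin

definition point :: "(nat list \<Rightarrow> 'k) \<Rightarrow> 'k whom" where
  "point l = sub P0 (\<lambda>_. l) (\<lambda>_. 0)"

definition mpoint :: "(nat list \<times> nat \<Rightarrow> 'k) \<Rightarrow> 'k whom" where
  "mpoint m = sub Q0 (\<lambda>_. 0) (\<lambda>_. m)"

text \<open>Elements of L(X) are the morphisms from P0 and elements of A(X)Y are the morphisms from Q0,
  so the functor acts on elements.\<close>

definition s :: "obj \<Rightarrow> (nat list \<Rightarrow> 'k) \<Rightarrow> nat list \<Rightarrow> 'k" where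
  "s A l = fst (Fm P0 A (point l)) (pgen px)"

definition t :: "obj \<Rightarrow> (nat list \<times> nat \<Rightarrow> 'k) \<Rightarrow> nat list \<times> nat \<Rightarrow> 'k" where
  "t A m = snd (Fm Q0 A (mpoint m)) (ygen qy)"

lemma point_hom: "l \<in> Lfree (fst A) \<Longrightarrow> point l \<in> homW P0 A"
  and mpoint_hom: "m \<in> AYfree (fst A) (snd A) \<Longrightarrow> mpoint m \<in> homW Q0 A"
  unfolding point_def mpoint_def by (auto intro: sub_P_hom sub_Q_hom)

lemma point_gen [simp]: "fst (point l) (pgen 0) = l" "snd (mpoint m) (ygen 0) = m"
  by (simp_all add: point_def mpoint_def)

lemma s_bij: "A \<in> Ob \<Longrightarrow> bij_betw (s A) (Lfree (fst A)) (Lfree (fst (Fo A)))"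
proof -
  assume A: "A \<in> Ob"
  have "bij_betw ((\<lambda>f. fst f (pgen px)) \<circ> (Fm P0 A \<circ> point)) (Lfree (fst A)) (Lfree (fst (Fo A)))"
    unfolding point_def
    by (intro bij_betw_trans[OF bij_betw_trans[OF bij_betw_P(1) Fm_bij]])
      (use A Fo_P0 bij_betw_P(2)[of px "Fo A"] in auto)
  then show ?thesis by (simp add: s_def[abs_def] comp_def)
qed

lemma t_bij: "A \<in> Ob \<Longrightarrow> bij_betw (t A) (AYfree (fst A) (snd A)) (AYfree (fst (Fo A)) (snd (Fo A)))"
proof -
  assume A: "A \<in> Ob"
  have "bij_betw ((\<lambda>f. snd f (ygen qy)) \<circ> (Fm Q0 A \<circ> mpoint))
      (AYfree (fst A) (snd A)) (AYfree (fst (Fo A)) (snd (Fo A)))"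
    unfolding mpoint_def
    by (intro bij_betw_trans[OF bij_betw_trans[OF bij_betw_Q(1) Fm_bij]])
      (use A Fo_Q0 bij_betw_Q(2)[of qy "Fo A"] in auto)
  then show ?thesis by (simp add: t_def[abs_def] comp_def)
qed

lemma s_in: "A \<in> Ob \<Longrightarrow> l \<in> Lfree (fst A) \<Longrightarrow> s A l \<in> Lfree (fst (Fo A))"
  using s_bij bij_betwE by blast

lemma t_in: "A \<in> Ob \<Longrightarrow> m \<in> AYfree (fst A) (snd A) \<Longrightarrow> t A m \<in> AYfree (fst (Fo A)) (snd (Fo A))"
  using t_bij bij_betwE by blast

lemma s_inj: "A \<in> Ob \<Longrightarrow> l \<in> Lfree (fst A) \<Longrightarrow> l' \<in> Lfree (fst A) \<Longrightarrow> s A l = s A l' \<Longrightarrow> l = l'"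
  using s_bij[of A] by (auto simp: bij_betw_def inj_on_def)

lemma t_inj: "A \<in> Ob \<Longrightarrow> m \<in> AYfree (fst A) (snd A) \<Longrightarrow> m' \<in> AYfree (fst A) (snd A) \<Longrightarrow>
    t A m = t A m' \<Longrightarrow> m = m'"
  using t_bij[of A] by (auto simp: bij_betw_def inj_on_def)

lemma s_surj: "A \<in> Ob \<Longrightarrow> l \<in> Lfree (fst (Fo A)) \<Longrightarrow> \<exists>l'\<in>Lfree (fst A). s A l' = l"
  using s_bij[of A] unfolding bij_betw_def by (metis imageE)

lemma t_surj: "A \<in> Ob \<Longrightarrow> m \<in> AYfree (fst (Fo A)) (snd (Fo A)) \<Longrightarrow> \<exists>m'\<in>AYfree (fst A) (snd A). t A m' = m"
  using t_bij[of A] unfolding bij_betw_def by (metis imageE)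

lemma s_natural:
  assumes "A \<in> Ob" "B \<in> Ob" "f \<in> homW A B" "l \<in> Lfree (fst A)"
  shows "s B (fst f l) = fst (Fm A B f) (s A l)"
proof -
  have "point (fst f l) = compW P0 f (point l)"
    using assms homW_fst_in[OF assms(3,4)]
    by (intro homW_P_eqI[OF point_hom compW_hom[OF point_hom]]) (auto simp: compW_gen Lfree.gen)
  then have "Fm P0 B (point (fst f l)) = compW ({px}, {}) (Fm A B f) (Fm P0 A (point l))"
    using Fm_comp[OF _ assms(1,2) point_hom[OF assms(4)] assms(3)] by (simp add: Fo_P0)
  then show ?thesis by (simp add: s_def compW_gen Lfree.gen)
qed

lemma t_natural:
  assumes "A \<in> Ob" "B \<in> Ob" "f \<in> homW A B" "m \<in> AYfree (fst A) (snd A)"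
  shows "t B (snd f m) = snd (Fm A B f) (t A m)"
proof -
  have "mpoint (snd f m) = compW Q0 f (mpoint m)"
    using assms homW_snd_in[OF assms(3,4)]
    by (intro homW_Q_eqI[OF mpoint_hom compW_hom[OF mpoint_hom]]) (auto simp: compW_gen)
  then have "Fm Q0 B (mpoint (snd f m)) = compW ({}, {qy}) (Fm A B f) (Fm Q0 A (mpoint m))"
    using Fm_comp[OF _ assms(1,2) mpoint_hom[OF assms(4)] assms(3)] by (simp add: Fo_Q0)
  then show ?thesis by (simp add: t_def compW_gen)
qed

text \<open>L(x) is a line, so \<open>s P0\<close> is a bijection between two lines; this is its
  expression in coordinates.\<close>

definition \<sigma> :: "'k \<Rightarrow> 'k" where
  "\<sigma> c = s P0 (psc c (pgen 0)) [px]"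

definition \<tau> :: "'k \<Rightarrow> 'k" where
  "\<tau> c = t Q0 (psc c (ygen 0)) ([], qy)"

lemma s_P0: "s P0 (psc c (pgen 0)) = psc (\<sigma> c) (pgen px)"
  using s_in[of P0 "psc c (pgen 0)"] Lfree_single[of "s P0 (psc c (pgen 0))" px]
  by (simp add: \<sigma>_def Fo_P0 Lfree.smul Lfree.gen)

lemma t_Q0: "t Q0 (psc c (ygen 0)) = psc (\<tau> c) (ygen qy)"
  using t_in[of Q0 "psc c (ygen 0)"] AYfree_single[of "t Q0 (psc c (ygen 0))" qy]
  by (simp add: \<tau>_def Fo_Q0 AYfree_psc)

text \<open>Every \<open>l\<close> is the value of \<open>point l\<close> at the generator of
  \<open>P0\<close>, so naturality spreads the rule for scalars from that line to all
  objects.\<close>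

lemma s_psc:
  assumes "A \<in> Ob" "l \<in> Lfree (fst A)"
  shows "s A (psc c l) = psc (\<sigma> c) (s A l)"
proof -
  have "s A (fst (point l) (psc c (pgen 0))) = fst (Fm P0 A (point l)) (psc (\<sigma> c) (pgen px))"
    using s_natural[OF _ assms(1) point_hom[OF assms(2)]] by (simp add: s_P0 Lfree.smul Lfree.gen)
  also have "\<dots> = psc (\<sigma> c) (s A l)"
    using homW_fst_psc[OF Fm_hom[OF _ assms(1) point_hom[OF assms(2)]]]
    by (simp add: s_def Fo_P0 Lfree.gen)
  also have "fst (point l) (psc c (pgen 0)) = psc c l"
    using homW_fst_psc[OF point_hom[OF assms(2)]] by (simp add: Lfree.gen)
  finally show ?thesis .
qed

lemma t_psc:
  assumes "A \<in> Ob" "m \<in> AYfree (fst A) (snd A)"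
  shows "t A (psc c m) = psc (\<tau> c) (t A m)"
proof -
  have "t A (snd (mpoint m) (psc c (ygen 0))) = snd (Fm Q0 A (mpoint m)) (psc (\<tau> c) (ygen qy))"
    using t_natural[OF _ assms(1) mpoint_hom[OF assms(2)]] by (simp add: t_Q0 AYfree_psc)
  also have "\<dots> = psc (\<tau> c) (t A m)"
    using homW_snd_psc[OF Fm_hom[OF _ assms(1) mpoint_hom[OF assms(2)]]]
    by (simp add: t_def Fo_Q0)
  also have "snd (mpoint m) (psc c (ygen 0)) = psc c m"
    using homW_snd_psc[OF mpoint_hom[OF assms(2)]] by simp
  finally show ?thesis .
qed

lemma s_zero: "A \<in> Ob \<Longrightarrow> s A 0 = 0"
proof -
  assume A: "A \<in> Ob"
  \<comment> \<open>The value \<open>\<sigma> 0\<close> is not known here. Writing 0 as 0 times a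
    preimage of 0 makes that factor multiply zero.\<close>
  obtain l where l: "l \<in> Lfree (fst P0)" "s P0 l = 0"
    using s_surj[of P0 0] by (auto simp: Lfree.zero)
  then have P: "s P0 0 = 0" using s_psc[of P0 l 0] by simp
  have "s A (fst (point 0) 0) = fst (Fm P0 A (point 0)) (s P0 0)"
    by (rule s_natural[OF Ob_simps(1) A point_hom]) (simp_all add: Lfree.zero)
  then show ?thesis
    using P homW_zero(1)[OF point_hom, of 0 A] homW_zero(1)[OF Fm_hom[OF _ A point_hom]]
    by (simp add: Lfree.zero)
qed

lemma t_zero: "A \<in> Ob \<Longrightarrow> t A 0 = 0"
proof -
  assume A: "A \<in> Ob"
  obtain m where m: "m \<in> AYfree (fst Q0) (snd Q0)" "t Q0 m = 0"
    using t_surj[of Q0 0] by auto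
  then have Q: "t Q0 0 = 0" using t_psc[of Q0 m 0] by simp
  have "t A (snd (mpoint 0) 0) = snd (Fm Q0 A (mpoint 0)) (t Q0 0)"
    by (rule t_natural[OF Ob_simps(2) A mpoint_hom]) simp_all
  then show ?thesis
    using Q homW_zero(2)[OF mpoint_hom, of 0 A] homW_zero(2)[OF Fm_hom[OF _ A mpoint_hom]]
    by simp
qed

text \<open>Pulling addition back along s is an operation given by an element w of the free Lie algebra
  on two generators. It commutes with multiplication by 2, so w is homogeneous of degree one, and
  0 being neutral forces w to be the sum of the generators.\<close>

lemma s_add:
  assumes A: "A \<in> Ob" and ab: "a \<in> Lfree (fst A)" "b \<in> Lfree (fst A)"
  shows "s A (a + b) = s A a + s A b"
proof -
  let ?B = "({0, 1}, {}) :: obj"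
  have B: "?B \<in> Ob" by (simp add: Ob_def)
  have g: "pgen 0 \<in> Lfree (fst ?B)" "pgen 1 \<in> Lfree (fst ?B)" by (auto intro: Lfree.gen)
  obtain w where w: "w \<in> Lfree (fst ?B)" and sw: "s ?B w = s ?B (pgen 0) + s ?B (pgen 1)"
    using s_surj[OF B Lfree.add[OF s_in[OF B g(1)] s_in[OF B g(2)]]] by blast
  have eval: "s A (fst f w) = s A (fst f (pgen 0)) + s A (fst f (pgen 1))"
    if "A \<in> Ob" "f \<in> homW ?B A" for f A
    unfolding s_natural[OF B that w] s_natural[OF B that g(1)] s_natural[OF B that g(2)] sw
    by (rule homW_fst_add[OF Fm_hom[OF B that]]) (use s_in[OF B g(1)] s_in[OF B g(2)] in auto)
  have w_supp: "w u = 0" if u: "u \<noteq> [0]" "u \<noteq> [1]" for u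
  proof (rule ccontr)
    assume nz: "w u \<noteq> 0"
    \<comment> \<open>Both sides acquire the factor \<open>\<sigma> 2\<close>, whose value is still
      unknown at this point.\<close>
    have "s ?B (fst (scale ?B (\<lambda>_. 2)) w) = s ?B (psc 2 w)"
      unfolding eval[OF B scale_hom] s_psc[OF B w] sw
      by (simp add: scale_gen s_psc[OF B g(1)] s_psc[OF B g(2)] psc_add del: One_nat_def)
    then have "fst (scale ?B (\<lambda>_. 2)) w = psc 2 w"
      by (rule s_inj[OF B homW_fst_in[OF scale_hom w] Lfree.smul[OF w]])
    from fun_cong[OF this, of u] have "2 ^ length u = (2 :: 'k)"
      using nz w by (simp add: scale_apply psc_apply map_replicate_const)
    then have "length u = 1" by (rule two_power_eq_two)
    then obtain z where "u = [z]" by (metis One_nat_def length_0_conv length_Suc_conv)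
    then show False using u Lfree_support[OF w nz] by auto
  qed
  define \<alpha> \<beta> where "\<alpha> = w [0]" and "\<beta> = w [1]"
  have w_eq: "w = psc \<alpha> (pgen 0) + psc \<beta> (pgen 1)"
    using w_supp by (auto simp: fun_eq_iff plus_fun_apply psc_apply pgen_def \<alpha>_def \<beta>_def)
  have fw: "fst f w = psc \<alpha> (fst f (pgen 0)) + psc \<beta> (fst f (pgen 1))" if "f \<in> homW ?B A" for f A
    using homW_fst_add[OF that Lfree.smul[OF g(1)] Lfree.smul[OF g(2)], of \<alpha> \<beta>]
      homW_fst_psc[OF that g(1)] homW_fst_psc[OF that g(2)]
    unfolding w_eq[symmetric] by (simp del: One_nat_def)
  have hom: "sub ?B (\<lambda>i. if i = 0 then a else b) (\<lambda>_. 0) \<in> homW ?B A"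
    if "a \<in> Lfree (fst A)" "b \<in> Lfree (fst A)" for a b :: "nat list \<Rightarrow> 'k" and A
    by (rule sub_hom) (use that in auto)
  have rule: "s A (psc \<alpha> a + psc \<beta> b) = s A a + s A b"
    if "A \<in> Ob" "a \<in> Lfree (fst A)" "b \<in> Lfree (fst A)" for A a b
    using eval[OF that(1) hom[OF that(2,3)]] fw[OF hom[OF that(2,3)]] by (simp add: sub_gen)
  have p0: "pgen 0 \<in> Lfree (fst P0)" by (simp add: Lfree.gen)
  \<comment> \<open>Putting one argument equal to 0 isolates a coefficient, which injectivity of
    \<open>s P0\<close> reads off whatever the twist on scalars is.\<close>
  have "s P0 (psc \<alpha> (pgen 0)) = s P0 (pgen 0)" "s P0 (psc \<beta> (pgen 0)) = s P0 (pgen 0)"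
    using rule[of P0 "pgen 0" 0] rule[of P0 0 "pgen 0"] p0 by (auto simp: Lfree.zero s_zero)
  then have "psc \<alpha> (pgen 0) = pgen 0" "psc \<beta> (pgen 0) = pgen 0"
    by (auto intro!: s_inj[OF Ob_simps(1)] Lfree.smul Lfree.gen)
  then have "\<alpha> = 1" "\<beta> = 1" by (simp_all add: psc_gen_eq_self)
  then show ?thesis using rule[OF A ab] by simp
qed

text \<open>Without letters, the module on two generators is just their span, so the degree is right
  from the start and only the two coefficients must be found, again from 0 being neutral.\<close>

lemma t_add:
  assumes A: "A \<in> Ob" and ab: "a \<in> AYfree (fst A) (snd A)" "b \<in> AYfree (fst A) (snd A)"
  shows "t A (a + b) = t A a + t A b"
proof -
  let ?B = "({}, {0, 1}) :: obj"
  have B: "?B \<in> Ob" by (simp add: Ob_def)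
  have g: "ygen 0 \<in> AYfree (fst ?B) (snd ?B)" "ygen 1 \<in> AYfree (fst ?B) (snd ?B)" by auto
  obtain w where w: "w \<in> AYfree (fst ?B) (snd ?B)" and tw: "t ?B w = t ?B (ygen 0) + t ?B (ygen 1)"
    using t_surj[OF B AYfree_add[OF t_in[OF B g(1)] t_in[OF B g(2)]]] by blast
  have eval: "t A (snd f w) = t A (snd f (ygen 0)) + t A (snd f (ygen 1))"
    if "A \<in> Ob" "f \<in> homW ?B A" for f A
    unfolding t_natural[OF B that w] t_natural[OF B that g(1)] t_natural[OF B that g(2)] tw
    by (rule homW_snd_add[OF Fm_hom[OF B that]]) (use t_in[OF B g(1)] t_in[OF B g(2)] in auto)
  define \<alpha> \<beta> where "\<alpha> = w ([], 0)" and "\<beta> = w ([], 1)"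
  have w_eq: "w = psc \<alpha> (ygen 0) + psc \<beta> (ygen 1)"
  proof
    show "w z = (psc \<alpha> (ygen 0) + psc \<beta> (ygen 1)) z" for z
      using w by (cases z) (auto simp: AYfree_def plus_fun_apply psc_apply ygen_def mon_def \<alpha>_def \<beta>_def)
  qed
  have fw: "snd f w = psc \<alpha> (snd f (ygen 0)) + psc \<beta> (snd f (ygen 1))" if "f \<in> homW ?B A" for f A
    using homW_snd_add[OF that AYfree_psc[OF g(1)] AYfree_psc[OF g(2)], of \<alpha> \<beta>]
      homW_snd_psc[OF that g(1)] homW_snd_psc[OF that g(2)]
    unfolding w_eq[symmetric] by (simp del: One_nat_def)
  have hom: "sub ?B (\<lambda>_. 0) (\<lambda>i. if i = 0 then a else b) \<in> homW ?B A"
    if "a \<in> AYfree (fst A) (snd A)" "b \<in> AYfree (fst A) (snd A)" for a b :: "nat list \<times> nat \<Rightarrow> 'k" and A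
    by (rule sub_hom) (use that in auto)
  have rule: "t A (psc \<alpha> a + psc \<beta> b) = t A a + t A b"
    if "A \<in> Ob" "a \<in> AYfree (fst A) (snd A)" "b \<in> AYfree (fst A) (snd A)" for A a b
    using eval[OF that(1) hom[OF that(2,3)]] fw[OF hom[OF that(2,3)]] by (simp add: sub_gen)
  have q0: "ygen 0 \<in> AYfree (fst Q0) (snd Q0)" by simp
  have "t Q0 (psc \<alpha> (ygen 0)) = t Q0 (ygen 0)" "t Q0 (psc \<beta> (ygen 0)) = t Q0 (ygen 0)"
    using rule[of Q0 "ygen 0" 0] rule[of Q0 0 "ygen 0"] q0 by (auto simp: t_zero)
  then have "psc \<alpha> (ygen 0) = ygen 0" "psc \<beta> (ygen 0) = ygen 0"
    by (auto intro!: t_inj[OF Ob_simps(2)] AYfree_psc)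
  then have "\<alpha> = 1" "\<beta> = 1" by (simp_all add: psc_gen_eq_self)
  then show ?thesis using rule[OF A ab] by simp
qed

text \<open>Additivity of \<open>s\<close> on the line gives additivity of \<open>\<sigma>\<close>,
  the scalar rule applied to a multiple of the generator gives multiplicativity, and bijectivity is
  that of \<open>s P0\<close>. Rigidity of the field finishes.\<close>

lemma \<sigma>_id: "\<sigma> = id"
proof (rule rigid)
  have p0: "psc c (pgen 0) \<in> Lfree (fst P0)" for c by (simp add: Lfree.gen Lfree.smul)
  have "\<sigma> (a + b) = \<sigma> a + \<sigma> b" for a b
    using s_add[OF _ p0 p0, of a b]
    by (simp add: s_P0 psc_add_left[symmetric])
  moreover have "\<sigma> (a * b) = \<sigma> a * \<sigma> b" for a b
    using s_psc[OF _ p0, of a b] by (simp add: s_P0)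
  moreover have "bij \<sigma>"
  proof (rule bijI)
    show "inj \<sigma>"
      using s_inj[of P0, OF _ p0 p0] by (intro injI) (simp add: s_P0)
    show "surj \<sigma>"
      unfolding surj_def
    proof
      fix c :: 'k
      have "psc c (pgen px) \<in> Lfree (fst (Fo P0))" by (simp add: Fo_P0 Lfree.gen Lfree.smul)
      then obtain l where l: "l \<in> Lfree {0}" "s P0 l = psc c (pgen px)" using s_surj[of P0] by auto
      have "psc (\<sigma> (l [0])) (pgen px) = psc c (pgen px)"
        using s_P0[of "l [0]"] l by (simp add: Lfree_single[OF l(1), symmetric])
      then show "\<exists>d. c = \<sigma> d" by auto
    qed
  qed
  ultimately show "field_aut \<sigma>" by (simp add: field_aut_def)
qed

lemma \<tau>_id: "\<tau> = id"
proof (rule rigid)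
  have q0: "psc c (ygen 0) \<in> AYfree (fst Q0) (snd Q0)" for c :: 'k by (simp add: AYfree_psc)
  have "\<tau> (a + b) = \<tau> a + \<tau> b" for a b
    using t_add[OF _ q0 q0, of a b]
    by (simp add: t_Q0 psc_add_left[symmetric])
  moreover have "\<tau> (a * b) = \<tau> a * \<tau> b" for a b
    using t_psc[OF _ q0, of a b] by (simp add: t_Q0)
  moreover have "bij \<tau>"
  proof (rule bijI)
    show "inj \<tau>"
      using t_inj[of Q0, OF _ q0 q0] by (intro injI) (simp add: t_Q0)
    show "surj \<tau>"
      unfolding surj_def
    proof
      fix c :: 'k
      have "psc c (ygen qy) \<in> AYfree (fst (Fo Q0)) (snd (Fo Q0))" by (simp add: Fo_Q0 AYfree_psc)
      then obtain m where m: "m \<in> AYfree {} {0}" "t Q0 m = psc c (ygen qy)" using t_surj[of Q0] by auto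
      have "psc (\<tau> (m ([], 0))) (ygen qy) = psc c (ygen qy)"
        using t_Q0[of "m ([], 0)"] m by (simp add: AYfree_single[OF m(1), symmetric])
      then show "\<exists>d. c = \<tau> d" by auto
    qed
  qed
  ultimately show "field_aut \<tau>" by (simp add: field_aut_def)
qed

lemma s_scale: "A \<in> Ob \<Longrightarrow> l \<in> Lfree (fst A) \<Longrightarrow> s A (psc c l) = psc c (s A l)"
  and t_scale: "A \<in> Ob \<Longrightarrow> m \<in> AYfree (fst A) (snd A) \<Longrightarrow> t A (psc c m) = psc c (t A m)"
  by (simp_all add: s_psc t_psc \<sigma>_id \<tau>_id)

text \<open>The transported bracket is again given by an element of the free Lie algebra on two generators;
  bilinearity puts it in bidegree (1,1) and antisymmetry makes it a multiple of the bracket.\<close>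

lemma s_br: "\<exists>c. \<forall>A\<in>Ob. \<forall>a\<in>Lfree (fst A). \<forall>b\<in>Lfree (fst A). pbr (s A a) (s A b) = psc c (s A (pbr a b))"
proof -
  let ?B = "({0, 1}, {}) :: obj"
  have B: "?B \<in> Ob" by (simp add: Ob_def)
  have g: "pgen 0 \<in> Lfree (fst ?B)" "pgen 1 \<in> Lfree (fst ?B)" by (auto intro: Lfree.gen)
  obtain w where w: "w \<in> Lfree (fst ?B)" and sw: "s ?B w = pbr (s ?B (pgen 0)) (s ?B (pgen 1))"
    using s_surj[OF B Lfree.br[OF s_in[OF B g(1)] s_in[OF B g(2)]]] by blast
  have eval: "s A (fst f w) = pbr (s A (fst f (pgen 0))) (s A (fst f (pgen 1)))"
    if "A \<in> Ob" "f \<in> homW ?B A" for f A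
    unfolding s_natural[OF B that w] s_natural[OF B that g(1)] s_natural[OF B that g(2)] sw
    by (rule homW_fst_br[OF Fm_hom[OF B that]]) (use s_in[OF B g(1)] s_in[OF B g(2)] in auto)
  \<comment> \<open>The two letters are scaled independently, which bilinearity of the target
    bracket permits; this detects the bidegree rather than the total degree.\<close>
  have scaled: "prod_list (map c u) * w u = c 0 * c 1 * w u" for c u
  proof -
    have "s ?B (fst (scale ?B c) w) = s ?B (psc (c 0 * c 1) w)"
      unfolding eval[OF B scale_hom] s_scale[OF B w] sw
      by (simp add: scale_gen s_scale[OF B g(1)] s_scale[OF B g(2)] mult.commute del: One_nat_def)
    then have "fst (scale ?B c) w = psc (c 0 * c 1) w"
      by (rule s_inj[OF B homW_fst_in[OF scale_hom w] Lfree.smul[OF w]])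
    from fun_cong[OF this, of u] show ?thesis
      using w by (simp add: scale_apply psc_apply)
  qed
  have w_supp: "w u = 0" if u: "u \<noteq> [0, 1]" "u \<noteq> [1, 0]" for u
  proof (rule ccontr)
    assume nz: "w u \<noteq> 0"
    \<comment> \<open>Scaling one letter by 2 and the other by 1 turns the factor into 2 to the
      number of occurrences of that letter.\<close>
    have "count_list u 0 = 1" "count_list u 1 = 1"
      using scaled[of "\<lambda>i. if i = 0 then 2 else 1" u] scaled[of "\<lambda>i. if i = 1 then 2 else 1" u] nz
      by (simp_all add: prod_list_indicator two_power_eq_two del: One_nat_def)
    moreover have sub: "set u \<subseteq> {0, 1}" using Lfree_support[OF w nz] by simp
    ultimately have "length u = 2" using count_two_letters[of u 0 1] by simp
    then obtain x y where "u = [x, y]" by (auto simp: numeral_2_eq_2 length_Suc_conv)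
    then show False using u sub \<open>count_list u 0 = 1\<close> by (auto split: if_splits)
  qed
  define \<alpha> \<beta> where "\<alpha> = w [0, 1]" and "\<beta> = w [1, 0]"
  have w_eq: "w = psc \<alpha> (mon [0, 1]) + psc \<beta> (mon [1, 0])"
    using w_supp by (auto simp: fun_eq_iff plus_fun_apply psc_apply mon_def \<alpha>_def \<beta>_def)
  have "\<alpha> + \<beta> = 0"
  proof -
    \<comment> \<open>Identifying the two generators makes the transported bracket that of an
      element with itself, while \<open>w\<close> collapses to \<open>\<alpha> + \<beta>\<close>
      times the word \<open>[0, 0]\<close>.\<close>
    let ?f = "sub ?B (\<lambda>_. pgen 0) (\<lambda>_. 0) :: 'k whom"
    have f: "?f \<in> homW ?B P0" by (rule sub_hom) (auto intro: Lfree.gen)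
    have "s P0 (fst ?f w) = s P0 0"
      unfolding eval[OF Ob_simps(1) f] by (simp add: sub_gen s_zero)
    then have 0: "fst ?f w = 0"
      using s_inj[OF Ob_simps(1) homW_fst_in[OF f w]] by (simp add: Lfree.zero)
    have fm: "finite {z. psc c (mon v) z \<noteq> 0}" for c :: 'k and v :: "nat list"
      by (rule finite_support_psc) (simp add: mon_def)
    have fm': "finite {z. mon v z \<noteq> (0 :: 'k)}" for v :: "nat list"
      by (simp add: mon_def)
    have "fst ?f w = subst_A (\<lambda>_. pgen 0) w" using w by (simp add: sub_def)
    also have "\<dots> = psc (\<alpha> + \<beta>) (mon [0, 0])"
      unfolding w_eq subst_A_def lext_add[OF fm fm] lext_psc[OF fm']
      by (simp add: pgen_eq_mon pmul_mon psc_add_left)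
    finally have "psc (\<alpha> + \<beta>) (mon [0, 0]) = (0 :: nat list \<Rightarrow> 'k)"
      using 0 by simp
    from fun_cong[OF this, of "[0, 0]"] show ?thesis by (simp add: psc_apply zero_fun_apply)
  qed
  then have "w = psc \<alpha> (pbr (pgen 0) (pgen 1))"
    unfolding w_eq by (simp add: eq_neg_iff_add_eq_0[symmetric] pbr_def pgen_eq_mon pmul_mon)
      (auto simp: fun_eq_iff plus_fun_apply minus_apply psc_apply algebra_simps add_eq_0_iff)
  then have fw: "fst f w = psc \<alpha> (pbr (fst f (pgen 0)) (fst f (pgen 1)))" if "f \<in> homW ?B A" for f A
    using homW_fst_psc[OF that Lfree.br[OF g]] homW_fst_br[OF that g] by simp
  have "pbr (s A a) (s A b) = psc \<alpha> (s A (pbr a b))"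
    if A: "A \<in> Ob" and ab: "a \<in> Lfree (fst A)" "b \<in> Lfree (fst A)" for A a b
  proof -
    let ?f = "sub ?B (\<lambda>i. if i = 0 then a else b) (\<lambda>_. 0)"
    have f: "?f \<in> homW ?B A" by (rule sub_hom) (use ab in auto)
    show ?thesis
      using eval[OF A f] unfolding fw[OF f]
      by (simp add: sub_gen s_scale[OF A Lfree.br[OF ab]])
  qed
  then show ?thesis by blast
qed

text \<open>The representing object is \<open>R0\<close>, with one generator of each sort. The
  transported action is an element of its module; doubling the letter doubles this element, so only
  the word of length one survives.\<close>

lemma t_pact: "\<exists>d. \<forall>A\<in>Ob. \<forall>l\<in>Lfree (fst A). \<forall>m\<in>AYfree (fst A) (snd A).
    pact (s A l) (t A m) = psc d (t A (pact l m))"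
proof -
  have g: "pgen 0 \<in> Lfree (fst R0)" "ygen 0 \<in> AYfree (fst R0) (snd R0)" by (auto intro: Lfree.gen)
  obtain w where w: "w \<in> AYfree (fst R0) (snd R0)" and tw: "t R0 w = pact (s R0 (pgen 0)) (t R0 (ygen 0))"
    using t_surj[OF Ob_simps(3) AYfree_pact_Lfree[OF s_in[OF Ob_simps(3) g(1)] t_in[OF Ob_simps(3) g(2)]]]
    by blast
  have eval: "t A (snd f w) = pact (s A (fst f (pgen 0))) (t A (snd f (ygen 0)))"
    if "A \<in> Ob" "f \<in> homW R0 A" for f A
    unfolding t_natural[OF Ob_simps(3) that w] s_natural[OF Ob_simps(3) that g(1)]
      t_natural[OF Ob_simps(3) that g(2)] tw
    by (rule homW_snd_pact[OF Fm_hom[OF Ob_simps(3) that] s_in[OF Ob_simps(3) g(1)] t_in[OF Ob_simps(3) g(2)]])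
  have w_supp: "w (u, y) = 0" if u: "(u, y) \<noteq> ([0], 0)" for u y
  proof (rule ccontr)
    assume nz: "w (u, y) \<noteq> 0"
    have "t R0 (snd (scale R0 (\<lambda>_. 2)) w) = t R0 (psc 2 w)"
      unfolding eval[OF Ob_simps(3) scale_hom] t_scale[OF Ob_simps(3) w] tw
      by (simp add: scale_gen s_scale[OF Ob_simps(3) g(1)])
    then have "snd (scale R0 (\<lambda>_. 2)) w = psc 2 w"
      by (rule t_inj[OF Ob_simps(3) homW_snd_in[OF scale_hom w] AYfree_psc[OF w]])
    from fun_cong[OF this, of "(u, y)"] have "2 ^ length u = (2 :: 'k)"
      using nz w by (simp add: scale_apply psc_apply map_replicate_const)
    then have "length u = 1" by (rule two_power_eq_two)
    then obtain z where "u = [z]" by (metis One_nat_def length_0_conv length_Suc_conv)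
    moreover have "set u \<subseteq> {0} \<and> y = 0" using w nz by (simp add: AYfree_def)
    ultimately show False using u by auto
  qed
  define \<delta> where "\<delta> = w ([0], 0)"
  have w_eq: "w = psc \<delta> (pact (pgen 0) (ygen 0))"
  proof
    show "w z = psc \<delta> (pact (pgen 0) (ygen 0)) z" for z
      using w_supp by (cases z) (auto simp: pact_pgen_ygen psc_apply mon_def \<delta>_def)
  qed
  have fw: "snd f w = psc \<delta> (pact (fst f (pgen 0)) (snd f (ygen 0)))" if "f \<in> homW R0 A" for f A
    using homW_snd_psc[OF that AYfree_pact_Lfree[OF g], of \<delta>] homW_snd_pact[OF that g]
    unfolding w_eq[symmetric] by simp
  have "pact (s A l) (t A m) = psc \<delta> (t A (pact l m))"
    if A: "A \<in> Ob" and lm: "l \<in> Lfree (fst A)" "m \<in> AYfree (fst A) (snd A)" for A l m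
  proof -
    let ?f = "sub R0 (\<lambda>_. l) (\<lambda>_. m)"
    have f: "?f \<in> homW R0 A" by (rule sub_hom) (use lm in auto)
    show ?thesis
      using eval[OF A f] unfolding fw[OF f]
      by (simp add: sub_gen t_scale[OF A AYfree_pact_Lfree[OF lm]])
  qed
  then show ?thesis by blast
qed

text \<open>The factors in the bracket law and in the action law have to agree before one rescaling
  of \<open>s\<close> can repair both, with \<open>t\<close> left as it is.\<close>

lemma iso_Fo:
  "\<exists>c. c \<noteq> 0 \<and> (\<forall>A\<in>Ob. (restrict (\<lambda>l. psc c (s A l)) (Lfree (fst A)),
      restrict (t A) (AYfree (fst A) (snd A))) \<in> homW A (Fo A))"
proof -
  obtain c where c: "\<And>A a b. A \<in> Ob \<Longrightarrow> a \<in> Lfree (fst A) \<Longrightarrow> b \<in> Lfree (fst A) \<Longrightarrow>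
      pbr (s A a) (s A b) = psc c (s A (pbr a b))"
    using s_br by blast
  obtain d where d: "\<And>A l m. A \<in> Ob \<Longrightarrow> l \<in> Lfree (fst A) \<Longrightarrow> m \<in> AYfree (fst A) (snd A) \<Longrightarrow>
      pact (s A l) (t A m) = psc d (t A (pact l m))"
    using t_pact by blast
  have "d \<noteq> 0"
  proof
    assume "d = 0"
    \<comment> \<open>Some object is sent onto \<open>R0\<close>, and there the letter acts on the
      module generator with nonzero result.\<close>
    obtain A where A: "A \<in> Ob" "Fo A = R0" using Fo_surj[of R0] by auto
    obtain l where l: "l \<in> Lfree (fst A)" "s A l = pgen 0"
      using s_surj[OF A(1), of "pgen 0"] A(2) by (auto simp: Lfree.gen)
    obtain m where m: "m \<in> AYfree (fst A) (snd A)" "t A m = ygen 0"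
      using t_surj[OF A(1), of "ygen 0"] A(2) by auto
    show False using d[OF A(1) l(1) m(1)] l(2) m(2) \<open>d = 0\<close> by (simp add: pact_pgen_ygen)
  qed
  have "c = d"
  proof -
    \<comment> \<open>In this object \<open>[a, b] m\<close> is nonzero. Transporting it directly
      produces \<open>c * d\<close>; expanding the bracket as a commutator of actions produces
      \<open>d * d\<close>.\<close>
    let ?A = "({0, 1}, {0}) :: obj"
    have A: "?A \<in> Ob" by (simp add: Ob_def)
    let ?a = "pgen 0 :: nat list \<Rightarrow> 'k" and ?b = "pgen 1 :: nat list \<Rightarrow> 'k" and ?m = "ygen 0 :: nat list \<times> nat \<Rightarrow> 'k"
    have ab: "?a \<in> Lfree (fst ?A)" "?b \<in> Lfree (fst ?A)" and m: "?m \<in> AYfree (fst ?A) (snd ?A)"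
      by (auto intro: Lfree.gen)
    note abm = AYfree_pact_Lfree[OF ab(1) m] AYfree_pact_Lfree[OF ab(2) m]
    note abm2 = AYfree_pact_Lfree[OF ab(1) abm(2)] AYfree_pact_Lfree[OF ab(2) abm(1)]
    define v where "v = pact (pbr ?a ?b) ?m"
    have v_eq: "v = pact ?a (pact ?b ?m) + psc (- 1) (pact ?b (pact ?a ?m))"
      by (simp add: v_def pact_pbr psc_uminus)
    have v: "v \<in> AYfree (fst ?A) (snd ?A)"
      unfolding v_def by (rule AYfree_pact_Lfree[OF Lfree.br[OF ab] m])
    have "psc (c * d) (t ?A v) = pact (pbr (s ?A ?a) (s ?A ?b)) (t ?A ?m)"
      unfolding v_def c[OF A ab] by (simp add: d[OF A Lfree.br[OF ab] m] del: One_nat_def)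
    also have "\<dots> = psc (d * d) (t ?A (pact ?a (pact ?b ?m))) - psc (d * d) (t ?A (pact ?b (pact ?a ?m)))"
      by (simp add: pact_pbr d[OF A ab(1) m] d[OF A ab(2) m] d[OF A ab(1) abm(2)] d[OF A ab(2) abm(1)]
          del: One_nat_def)
    also have "\<dots> = psc (d * d) (t ?A v)"
      unfolding v_eq t_add[OF A abm2(1) AYfree_psc[OF abm2(2)]] t_scale[OF A abm2(2)]
      by (simp add: psc_add psc_uminus[symmetric])
    finally have eq: "psc (c * d) (t ?A v) = psc (d * d) (t ?A v)" .
    have "v ([0, 1], 0) = 1"
      unfolding v_def pact_pbr ygen_def pgen_eq_mon pact_mon by (simp add: minus_apply mon_def)
    then have "v \<noteq> 0" by (auto simp: zero_fun_apply)
    then have "t ?A v \<noteq> 0" using t_inj[OF A v AYfree_zero] t_zero[OF A] by auto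
    then obtain z where "t ?A v z \<noteq> 0" by (auto simp: fun_eq_iff zero_fun_apply)
    then have "c * d = d * d" using fun_cong[OF eq, of z] by (simp add: psc_apply)
    then show ?thesis using \<open>d \<noteq> 0\<close> by simp
  qed
  \<comment> \<open>The bracket is quadratic in \<open>s\<close> and its image linear, so the factor
    \<open>1 / c\<close> absorbs \<open>c\<close>; the action is linear in \<open>s\<close>, so the
    same factor absorbs \<open>d\<close>.\<close>
  have "(restrict (\<lambda>l. psc (1 / c) (s A l)) (Lfree (fst A)),
      restrict (t A) (AYfree (fst A) (snd A))) \<in> homW A (Fo A)" if A: "A \<in> Ob" for A
    using \<open>c = d\<close> \<open>d \<noteq> 0\<close>
    unfolding homW_def hom_gen_def
    by (auto simp: A Lfree.intros AYfree_add AYfree_psc AYfree_pact_Lfree s_in t_in s_add t_add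
        s_scale t_scale psc_add c d mult.commute)
  then show ?thesis using \<open>c = d\<close> \<open>d \<noteq> 0\<close> by (intro exI[of _ "1 / c"]) auto
qed

end

section \<open>Comparison of automorphic and geometric equivalence\<close>

lemma geom_equiv_of_auto_equiv:
  fixes H1 :: "('k::field_char_0, 'l1::ab_group_add, 'v1::ab_group_add) rep"
    and H2 :: "('k, 'l2::ab_group_add, 'v2::ab_group_add) rep"
  assumes rigid: "\<forall>\<sigma> :: 'k \<Rightarrow> 'k. field_aut \<sigma> \<longrightarrow> \<sigma> = id"
    and H1: "is_rep H1" and H2: "is_rep H2" and equiv: "auto_equiv H1 H2"
  shows "geom_equiv H1 H2"
proof -
  obtain Fo and Fm :: "obj \<Rightarrow> obj \<Rightarrow> 'k whom \<Rightarrow> 'k whom" and \<alpha>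
    where cat: "cat_auto Fo Fm"
      and \<alpha>': "\<forall>W\<in>Ob. bij_betw (\<alpha> W) (closed_H H1 W) (closed_H H2 (Fo W))"
      and beta': "\<forall>W1\<in>Ob. \<forall>W2\<in>Ob. \<forall>T\<in>closed_H H1 W2.
        (\<lambda>(f, g). (Fm W1 W2 f, Fm W1 W2 g)) ` beta W1 W2 T = beta (Fo W1) (Fo W2) (\<alpha> W2 T)"
    using equiv unfolding auto_equiv_def by (elim exE conjE) (rule that)
  note \<alpha> = \<alpha>'[rule_format] and beta = beta'[rule_format]
  interpret category_auto Fo Fm by unfold_locales (rule cat)
  obtain px qy where pq: "Fo P0 = ({px}, {})" "Fo Q0 = ({}, {qy})" using Fo_rank_one by blast
  interpret pointed_category_auto Fo Fm px qy
    by unfold_locales (use pq rigid in auto)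
  obtain c where c: "c \<noteq> 0" and iso: "\<And>A. A \<in> Ob \<Longrightarrow> (restrict (\<lambda>l. psc c (s A l)) (Lfree (fst A)),
      restrict (t A) (AYfree (fst A) (snd A))) \<in> homW A (Fo A)"
    using iso_Fo by blast
  \<comment> \<open>The hypothesis on \<open>beta\<close> is an equality of image sets; injectivity
    on morphisms sharpens it to a test for each single pair.\<close>
  have beta_Fm: "(Fm W1 W2 f, Fm W1 W2 g) \<in> beta (Fo W1) (Fo W2) (\<alpha> W2 T) \<longleftrightarrow> (f, g) \<in> beta W1 W2 T"
    if asm: "W1 \<in> Ob" "W2 \<in> Ob" "T \<in> closed_H H1 W2" "f \<in> homW W1 W2" "g \<in> homW W1 W2" for W1 W2 T f g
  proof
    assume "(Fm W1 W2 f, Fm W1 W2 g) \<in> beta (Fo W1) (Fo W2) (\<alpha> W2 T)"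
    then obtain f' g' where "(f', g') \<in> beta W1 W2 T" "Fm W1 W2 f = Fm W1 W2 f'" "Fm W1 W2 g = Fm W1 W2 g'"
      unfolding beta[OF asm(1-3), symmetric] by auto
    moreover from this(1) have "f' \<in> homW W1 W2" "g' \<in> homW W1 W2" by (auto simp: beta_def)
    ultimately show "(f, g) \<in> beta W1 W2 T" using Fm_inj[OF asm(1,2)] asm(4,5) by metis
  next
    assume "(f, g) \<in> beta W1 W2 T"
    then show "(Fm W1 W2 f, Fm W1 W2 g) \<in> beta (Fo W1) (Fo W2) (\<alpha> W2 T)"
      unfolding beta[OF asm(1-3), symmetric] by force
  qed
  \<comment> \<open>The letter is arbitrary because this is applied both to \<open>P0\<close> and to
    its image. All other differences are multiples of the one at the generator.\<close>
  have beta_P: "(f, g) \<in> beta ({x}, {}) W T \<longleftrightarrow> fst f (pgen x) - fst g (pgen x) \<in> fst T"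
    if "f \<in> homW ({x}, {}) W" "g \<in> homW ({x}, {}) W"
      and T: "0 \<in> snd T" "\<And>l c. l \<in> fst T \<Longrightarrow> psc c l \<in> fst T" for f g :: "'k whom" and x W T
  proof
    assume "(f, g) \<in> beta ({x}, {}) W T"
    then show "fst f (pgen x) - fst g (pgen x) \<in> fst T" by (auto simp: beta_def Lfree.gen)
  next
    assume *: "fst f (pgen x) - fst g (pgen x) \<in> fst T"
    have "fst f l - fst g l \<in> fst T" if l: "l \<in> Lfree {x}" for l
    proof -
      have "fst f l - fst g l = psc (l [x]) (fst f (pgen x) - fst g (pgen x))"
        using Lfree_single[OF l] homW_fst_psc[OF \<open>f \<in> _\<close>, of "pgen x" "l [x]"]
          homW_fst_psc[OF \<open>g \<in> _\<close>, of "pgen x" "l [x]"] by (simp add: Lfree.gen psc_diff)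
      then show ?thesis using T(2)[OF *] by simp
    qed
    moreover have "snd f v - snd g v \<in> snd T" if "v \<in> AYfree {x} {}" for v
      using AYfree_empty[OF that] homW_zero(2)[OF \<open>f \<in> _\<close>] homW_zero(2)[OF \<open>g \<in> _\<close>] T(1) by simp
    ultimately show "(f, g) \<in> beta ({x}, {}) W T" using that(1,2) by (simp add: beta_def)
  qed
  have beta_Q: "(f, g) \<in> beta ({}, {y}) W T \<longleftrightarrow> snd f (ygen y) - snd g (ygen y) \<in> snd T"
    if "f \<in> homW ({}, {y}) W" "g \<in> homW ({}, {y}) W"
      and T: "0 \<in> fst T" "\<And>v c. v \<in> snd T \<Longrightarrow> psc c v \<in> snd T" for f g :: "'k whom" and y W T
  proof
    assume "(f, g) \<in> beta ({}, {y}) W T"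
    then show "snd f (ygen y) - snd g (ygen y) \<in> snd T" by (auto simp: beta_def)
  next
    assume *: "snd f (ygen y) - snd g (ygen y) \<in> snd T"
    have "snd f v - snd g v \<in> snd T" if v: "v \<in> AYfree {} {y}" for v
    proof -
      have "snd f v - snd g v = psc (v ([], y)) (snd f (ygen y) - snd g (ygen y))"
        using AYfree_single[OF v] homW_snd_psc[OF \<open>f \<in> _\<close>, of "ygen y" "v ([], y)"]
          homW_snd_psc[OF \<open>g \<in> _\<close>, of "ygen y" "v ([], y)"] by (simp add: psc_diff)
      then show ?thesis using T(2)[OF *] by simp
    qed
    moreover have "fst f l - fst g l \<in> fst T" if "l \<in> Lfree {}" for l
      using Lfree_empty[OF that] homW_zero(1)[OF \<open>f \<in> _\<close>] homW_zero(1)[OF \<open>g \<in> _\<close>] T(1) by simp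
    ultimately show "(f, g) \<in> beta ({}, {y}) W T" using that(1,2) by (simp add: beta_def)
  qed
  have "closed_H H1 W = closed_H H2 W" if W: "W \<in> Ob" for W
  proof -
    define h :: "'k whom" where "h = (restrict (\<lambda>l. psc c (s W l)) (Lfree (fst W)),
      restrict (t W) (AYfree (fst W) (snd W)))"
    have h: "h \<in> homW W (Fo W)" unfolding h_def by (rule iso[OF W])
    have "bij_betw (psc c \<circ> s W) (Lfree (fst W)) (Lfree (fst (Fo W)))"
      by (rule bij_betw_trans[OF s_bij[OF W] bij_betw_psc[OF c]])
    then have b1: "bij_betw (fst h) (Lfree (fst W)) (Lfree (fst (Fo W)))"
      by (subst bij_betw_cong[where g = "psc c \<circ> s W"]) (auto simp: h_def)
    have b2: "bij_betw (snd h) (AYfree (fst W) (snd W)) (AYfree (fst (Fo W)) (snd (Fo W)))"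
      by (subst bij_betw_cong[where g = "t W"]) (auto simp: h_def t_bij[OF W])
    obtain g where g: "g \<in> homW (Fo W) W"
      "\<And>l. l \<in> Lfree (fst W) \<Longrightarrow> fst g (fst h l) = l" "\<And>v. v \<in> AYfree (fst W) (snd W) \<Longrightarrow> snd g (snd h v) = v"
      "\<And>l. l \<in> Lfree (fst (Fo W)) \<Longrightarrow> fst h (fst g l) = l"
      "\<And>v. v \<in> AYfree (fst (Fo W)) (snd (Fo W)) \<Longrightarrow> snd h (snd g v) = v"
      by (rule homW_inverse[OF h b1 b2]) (rule that)
    have \<alpha>_eq: "\<alpha> W T = (fst h ` fst T, snd h ` snd T)" if T: "T \<in> closed_H H1 W" for T
    proof -
      have \<alpha>T: "\<alpha> W T \<in> closed_H H2 (Fo W)" using \<alpha>[OF W] T by (rule bij_betwE[rule_format])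
      note T_sub = closed_HD(1,2)[OF T] and \<alpha>T_sub = closed_HD(1,2)[OF \<alpha>T]
      note T0 = closed_H_subspace[OF H1 T] and \<alpha>T0 = closed_H_subspace[OF H2 \<alpha>T]
      \<comment> \<open>The morphism picking out \<open>l\<close> is compared with the one picking
        out 0; since \<open>s W 0 = 0\<close>, the difference after applying the functor is
        \<open>s W l\<close> itself.\<close>
      have s_iff: "s W l \<in> fst (\<alpha> W T) \<longleftrightarrow> l \<in> fst T" if l: "l \<in> Lfree (fst W)" for l
      proof -
        note homs = point_hom[OF l] point_hom[OF Lfree.zero]
        have "s W l \<in> fst (\<alpha> W T) \<longleftrightarrow> (Fm P0 W (point l), Fm P0 W (point 0)) \<in> beta (Fo P0) (Fo W) (\<alpha> W T)"
          using beta_P[of "Fm P0 W (point l)" px "Fo W" "Fm P0 W (point 0)" "\<alpha> W T"]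
            Fm_hom[OF _ W homs(1)] Fm_hom[OF _ W homs(2)] \<alpha>T0 s_zero[OF W]
          by (simp add: Fo_P0 s_def)
        also have "\<dots> \<longleftrightarrow> (point l, point 0) \<in> beta P0 W T"
          by (rule beta_Fm[OF _ W T homs]) simp
        also have "\<dots> \<longleftrightarrow> l \<in> fst T"
          using beta_P[OF homs T0(2,3)] by simp
        finally show ?thesis .
      qed
      have t_iff: "t W v \<in> snd (\<alpha> W T) \<longleftrightarrow> v \<in> snd T" if v: "v \<in> AYfree (fst W) (snd W)" for v
      proof -
        note homs = mpoint_hom[OF v] mpoint_hom[OF AYfree_zero]
        have "t W v \<in> snd (\<alpha> W T) \<longleftrightarrow> (Fm Q0 W (mpoint v), Fm Q0 W (mpoint 0)) \<in> beta (Fo Q0) (Fo W) (\<alpha> W T)"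
          using beta_Q[of "Fm Q0 W (mpoint v)" qy "Fo W" "Fm Q0 W (mpoint 0)" "\<alpha> W T"]
            Fm_hom[OF _ W homs(1)] Fm_hom[OF _ W homs(2)] \<alpha>T0 t_zero[OF W]
          by (simp add: Fo_Q0 t_def)
        also have "\<dots> \<longleftrightarrow> (mpoint v, mpoint 0) \<in> beta Q0 W T"
          by (rule beta_Fm[OF _ W T homs]) simp
        also have "\<dots> \<longleftrightarrow> v \<in> snd T"
          using beta_Q[OF homs T0(1,4)] by simp
        finally show ?thesis .
      qed
      have "fst h l \<in> fst (\<alpha> W T) \<longleftrightarrow> l \<in> fst T" if l: "l \<in> Lfree (fst W)" for l
      proof -
        have "fst h l = psc c (s W l)" using l by (simp add: h_def)
        \<comment> \<open>The map \<open>h\<close> differs from \<open>s W\<close> by a nonzero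
          scalar, and closed pairs are stable under scalars in both directions.\<close>
        moreover have "s W l = psc (1 / c) (psc c (s W l))" using c by simp
        ultimately show ?thesis using \<alpha>T0(3) s_iff[OF l] by metis
      qed
      then have "fst (\<alpha> W T) = fst h ` fst T"
        using T_sub(1) \<alpha>T_sub(1) g(4) homW_fst_in[OF g(1)] by (auto simp: subset_iff image_iff) metis
      moreover have "snd (\<alpha> W T) = snd h ` snd T"
      proof -
        have "snd h v \<in> snd (\<alpha> W T) \<longleftrightarrow> v \<in> snd T" if v: "v \<in> AYfree (fst W) (snd W)" for v
          using t_iff[OF v] v by (simp add: h_def)
        then show ?thesis
          using T_sub(2) \<alpha>T_sub(2) g(5) homW_snd_in[OF g(1)] by (auto simp: subset_iff image_iff) metis
      qed
      ultimately show ?thesis by (simp add: prod_eq_iff)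
    qed
    have cancel: "(fst g ` fst h ` fst T, snd g ` snd h ` snd T) = T"
      if "fst T \<subseteq> Lfree (fst W)" "snd T \<subseteq> AYfree (fst W) (snd W)" for T
    proof -
      have "fst g ` fst h ` fst T = id ` fst T" "snd g ` snd h ` snd T = id ` snd T"
        unfolding image_image using that g(2,3) by (intro image_cong; force)+
      then show ?thesis by simp
    qed
    show ?thesis
    proof (intro equalityI subsetI)
      fix T assume T: "T \<in> closed_H H1 W"
      have "\<alpha> W T \<in> closed_H H2 (Fo W)" using \<alpha>[OF W] T by (rule bij_betwE[rule_format])
      from closed_H_image[OF g(1) h g(4,5,2,3) this] show "T \<in> closed_H H2 W"
        by (simp add: \<alpha>_eq[OF T] cancel[OF closed_HD(1,2)[OF T]])
    next
      fix T assume T: "T \<in> closed_H H2 W"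
      \<comment> \<open>An \<open>H2\<close>-closed pair is pushed to the image of \<open>W\<close>,
        where surjectivity of \<open>\<alpha> W\<close> provides an \<open>H1\<close>-closed pair
        with the same image under \<open>h\<close>; cancelling \<open>h\<close> shows that the two
        coincide.\<close>
      have "(fst h ` fst T, snd h ` snd T) \<in> closed_H H2 (Fo W)"
        by (rule closed_H_image[OF h g T])
      then have "(fst h ` fst T, snd h ` snd T) \<in> \<alpha> W ` closed_H H1 W"
        using \<alpha>[OF W] by (simp add: bij_betw_def)
      then obtain T' where "(fst h ` fst T, snd h ` snd T) = \<alpha> W T'" "T' \<in> closed_H H1 W"
        by (rule imageE)
      note T' = this(2) this(1)[symmetric]
      have "T' = T"
        using \<alpha>_eq[OF T'(1)] T'(2) cancel[OF closed_HD(1,2)[OF T'(1)]] cancel[OF closed_HD(1,2)[OF T]]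
        by (metis prod.inject)
      then show "T \<in> closed_H H1 W" using T'(1) by simp
    qed
  qed
  then show ?thesis by (simp add: geom_equiv_iff_closed)
qed

text \<open>The identity automorphism suffices, since equal families of closed pairs allow the
  identity as \<open>\<alpha>\<close>.\<close>

lemma auto_equiv_of_geom_equiv:
  fixes H1 :: "('k::field_char_0, 'l1::ab_group_add, 'v1::ab_group_add) rep"
    and H2 :: "('k, 'l2::ab_group_add, 'v2::ab_group_add) rep"
  assumes "geom_equiv H1 H2"
  shows "auto_equiv H1 H2"
  unfolding auto_equiv_def
proof (intro exI conjI)
  show "cat_auto id (\<lambda>_ _. id :: 'k whom \<Rightarrow> 'k whom)"
    by (simp add: cat_auto_def)
  show "\<forall>W\<in>Ob. bij_betw id (closed_H H1 W) (closed_H H2 (id W))"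
    using assms by (simp add: geom_equiv_iff_closed)
qed auto

theorem theorem8:
  fixes H1 :: "('k::field_char_0, 'l1::ab_group_add, 'v1::ab_group_add) rep"
    and H2 :: "('k, 'l2::ab_group_add, 'v2::ab_group_add) rep"
  assumes "infinite (UNIV :: 'k set)"
    and "\<forall>\<sigma> :: 'k \<Rightarrow> 'k. field_aut \<sigma> \<longrightarrow> \<sigma> = id"
    and "is_rep H1" and "is_rep H2"
  shows "auto_equiv H1 H2 \<longleftrightarrow> geom_equiv H1 H2"
  using geom_equiv_of_auto_equiv[OF assms(2-4)] auto_equiv_of_geom_equiv by blast

end
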